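(* Let $m\ge2$ and $n\ge2$ be integers with $m$ odd and $2m<n$, and let $0<\sigma<\frac{n}{n-2m}$. Set $b=\frac{2m(n-2)}{n-\sigma(n-2m)}$. Let $g:\mathbb{R}^n\setminus B_{1/2}(0)\to[1,\infty)$ be continuous with $g(y)=O(|y|^b)$ as $|y|\to\infty$. Let $v$ be a $C^{2m}$ nonnegative solution of $$0\le-\Delta^m v\le(v+g)^\sigma\quad\text{in }\mathbb{R}^n\setminus B_{1/2}(0).$$ Then $v(y)=O(|y|^b)$ as $|y|\to\infty$.
   Context: $\Delta^m$ is the $m$-fold iterated Laplacian; $B_{1/2}(0)$ is the open ball of radius $1/2$ about the origin. *)

theory Defs
  imports "HOL-Analysis.Analysis" "HOL-Library.Landau_Symbols"
begin

definition partial_deriv :: "'n::finite \<Rightarrow> (real^'n \<Rightarrow> real) \<Rightarrow> real^'n \<Rightarrow> real" where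
  "partial_deriv i f x = deriv (\<lambda>t. f (x + t *\<^sub>R axis i 1)) 0"

fun iter_partial :: "'n::finite list \<Rightarrow> (real^'n \<Rightarrow> real) \<Rightarrow> real^'n \<Rightarrow> real" where
  "iter_partial [] f = f"
| "iter_partial (j # js) f = partial_deriv j (iter_partial js f)"

definition Ck_on :: "nat \<Rightarrow> (real^'n::finite \<Rightarrow> real) \<Rightarrow> (real^'n) set \<Rightarrow> bool" where
  "Ck_on k f S \<longleftrightarrow>
     (\<forall>js. length js \<le> k \<longrightarrow> continuous_on S (iter_partial js f)) \<and>
     (\<forall>js i. length js < k \<longrightarrow>
        (\<forall>x\<in>S. (\<lambda>t. iter_partial js f (x + t *\<^sub>R axis i 1)) differentiable (at 0)))"

definition laplacian :: "(real^'n::finite \<Rightarrow> real) \<Rightarrow> real^'n \<Rightarrow> real" where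
  "laplacian f x = (\<Sum>i\<in>UNIV. partial_deriv i (partial_deriv i f) x)"

end

theory Submission
  imports Defs
begin

text \<open>
  Put \<open>f = - \<Delta>\<^sup>m v \<ge> 0\<close> and let \<open>n\<close> be the dimension. The proof only tests \<open>f\<close> against explicit compactly
  supported functions.

  Global step. In \<open>r = |y|\<close>, the Laplacian maps the cone spanned by the functions \<open>r\<^sup>-\<^sup>k (1 - r/R)\<^sup>j\<close>
  with \<open>k \<ge> n - 2\<close> into itself, so a test function equal to \<open>r\<^sup>2\<^sup>-\<^sup>n (1 - r/R)\<^sub>+\<^sup>N\<close> for \<open>r \<ge> 1\<close> has
  \<open>\<Delta>\<^sup>m\<close> positive there, and only a bounded error for \<open>r \<le> 1\<close>. Hence on \<open>1 \<le> |y| \<le> R\<close> the integral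
  of \<open>v\<close> is \<open>O(R\<^sup>n\<^sup>+\<^sup>2\<^sup>m\<^sup>-\<^sup>2)\<close> and that of \<open>f\<close> is \<open>O(R\<^sup>n\<^sup>-\<^sup>2)\<close>.

  Local step. For \<open>s = |x - z|\<^sup>2 + \<epsilon>\<^sup>2\<close> one has
  \<open>(-\<Delta>)\<^sup>m s\<^bsup>m - n/2\<^esup> = \<kappa> \<epsilon>\<^sup>2\<^sup>m s\<^bsup>- m - n/2\<^esup>\<close> with \<open>\<kappa> > 0\<close>, a multiple of an approximate identity.
  As \<open>m\<close> is odd, testing with a truncation of \<open>s\<^bsup>m - n/2\<^esup>\<close> and letting \<open>\<epsilon> \<rightarrow> 0\<close> bounds \<open>v z\<close> by the mean
  of \<open>v\<close> over a ball plus the Riesz potential of \<open>f\<close>; the latter is interpolated between \<open>sup f\<close> and the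
  integral of \<open>f\<close>.

  Conclusion. On the ball of radius \<open>R/2\<close> about \<open>y\<close>, \<open>R = |y|\<close>, maximise
  \<open>(R/2 - |x - y|)\<^sup>n (v x + G R\<^sup>b)\<close> and apply the local estimate at the maximum point; the exponent
  \<open>\<theta> = \<sigma> (n - 2m)/n < 1\<close> of the maximum makes the resulting inequality sublinear, and
  \<open>b (1 - \<theta>) = 2m(n - 2)/n\<close>.
\<close>

subsection \<open>Calculus of iterated partial derivatives\<close>

text \<open>Relational form of \<open>partial_deriv\<close>: \<open>deriv\<close> has a value even
  where no derivative exists, so the calculus rules carry existence and value together.\<close>

definition has_partial :: "'n::finite \<Rightarrow> (real^'n \<Rightarrow> real) \<Rightarrow> real^'n \<Rightarrow> real \<Rightarrow> bool" where
  "has_partial i f x D \<longleftrightarrow> ((\<lambda>t. f (x + t *\<^sub>R axis i 1)) has_real_derivative D) (at 0)"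

lemma has_partial_partial_deriv: "has_partial i f x D \<Longrightarrow> partial_deriv i f x = D"
  unfolding has_partial_def partial_deriv_def by (rule DERIV_imp_deriv)

lemma differentiable_has_partial:
  "(\<lambda>t. f (x + t *\<^sub>R axis i 1)) differentiable (at 0) \<longleftrightarrow> has_partial i f x (partial_deriv i f x)"
  unfolding has_partial_def partial_deriv_def
  using DERIV_deriv_iff_real_differentiable by blast

text \<open>The head of the list is the derivative applied last, so the one taken first sits at the
  end.\<close>

lemma iter_partial_snoc: "iter_partial (js @ [i]) f = iter_partial js (partial_deriv i f)"
  by (induction js) auto

lemma Ck_on_0: "Ck_on 0 f S \<longleftrightarrow> continuous_on S f"
  by (auto simp: Ck_on_def)

lemma Ck_on_imp_continuous: "Ck_on k f S \<Longrightarrow> continuous_on S f"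
  unfolding Ck_on_def by (metis iter_partial.simps(1) le0 list.size(3))

lemma Ck_on_mono: "Ck_on k f S \<Longrightarrow> j \<le> k \<Longrightarrow> Ck_on j f S"
  unfolding Ck_on_def by auto

lemma Ck_on_subset: "Ck_on k f S \<Longrightarrow> T \<subseteq> S \<Longrightarrow> Ck_on k f T"
  unfolding Ck_on_def by (meson continuous_on_subset subsetD)

text \<open>Recursive form of C^k on which the closure proofs below induct; it comes from splitting
  off the last list entry, the derivative taken first.\<close>

lemma Ck_on_Suc:
  "Ck_on (Suc k) f S \<longleftrightarrow> continuous_on S f \<and>
     (\<forall>i. Ck_on k (partial_deriv i f) S \<and> (\<forall>x\<in>S. has_partial i f x (partial_deriv i f x)))"
  (is "?L \<longleftrightarrow> ?R")
proof
  assume L: ?L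
  have "Ck_on k (partial_deriv i f) S" for i
    unfolding Ck_on_def
  proof (intro conjI allI impI)
    fix js :: "'a list" assume "length js \<le> k"
    then have "length (js @ [i]) \<le> Suc k" by simp
    then show "continuous_on S (iter_partial js (partial_deriv i f))"
      using L unfolding Ck_on_def by (metis iter_partial_snoc)
  next
    fix js :: "'a list" and i' assume "length js < k"
    then have "length (js @ [i]) < Suc k" by simp
    then show "\<forall>x\<in>S. (\<lambda>t. iter_partial js (partial_deriv i f) (x + t *\<^sub>R axis i' 1)) differentiable at 0"
      using L unfolding Ck_on_def by (metis iter_partial_snoc)
  qed
  moreover have "has_partial i f x (partial_deriv i f x)" if "x \<in> S" for i x
  proof -
    have "(\<lambda>t. iter_partial [] f (x + t *\<^sub>R axis i 1)) differentiable at 0"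
      using L that unfolding Ck_on_def by (metis list.size(3) zero_less_Suc)
    then show ?thesis by (simp add: differentiable_has_partial)
  qed
  ultimately show ?R using Ck_on_imp_continuous[OF L] by auto
next
  assume R: ?R
  show ?L
    unfolding Ck_on_def
  proof (intro conjI allI impI)
    fix js :: "'a list" assume l: "length js \<le> Suc k"
    show "continuous_on S (iter_partial js f)"
    proof (cases js rule: rev_cases)
      case Nil then show ?thesis using R by simp
    next
      case (snoc ys y)
      then have "length ys \<le> k" using l by simp
      then show ?thesis using R snoc by (simp add: iter_partial_snoc Ck_on_def)
    qed
  next
    fix js :: "'a list" and i' assume l: "length js < Suc k"
    show "\<forall>x\<in>S. (\<lambda>t. iter_partial js f (x + t *\<^sub>R axis i' 1)) differentiable at 0"
    proof (cases js rule: rev_cases)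
      case Nil then show ?thesis using R by (simp add: differentiable_has_partial)
    next
      case (snoc ys y)
      then have "length ys < k" using l by simp
      then show ?thesis using R snoc by (simp add: iter_partial_snoc Ck_on_def)
    qed
  qed
qed

section \<open>Locality of partial derivatives and of C^k regularity\<close>

lemma eventually_line:
  fixes S :: "(real^'n::finite) set"
  assumes "open S" "x \<in> S"
  shows "eventually (\<lambda>t. x + t *\<^sub>R axis i 1 \<in> S) (nhds (0::real))"
proof -
  have "open ((\<lambda>t::real. x + t *\<^sub>R axis i 1) -` S)"
    by (intro open_vimage assms continuous_intros)
  from eventually_nhds_in_open[OF this, of 0] show ?thesis using assms by simp
qed

lemma has_partial_cong:
  assumes "open S" "x \<in> S" "\<And>y. y \<in> S \<Longrightarrow> f y = g y"
  shows "has_partial i f x D \<longleftrightarrow> has_partial i g x D"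
  unfolding has_partial_def
  by (rule DERIV_cong_ev) (auto intro!: eventually_mono[OF eventually_line[OF assms(1,2), of i]] assms)

lemma partial_deriv_cong:
  assumes "open S" "x \<in> S" "\<And>y. y \<in> S \<Longrightarrow> f y = g y"
  shows "partial_deriv i f x = partial_deriv i g x"
  unfolding partial_deriv_def
  by (rule deriv_cong_ev) (auto intro!: eventually_mono[OF eventually_line[OF assms(1,2), of i]] assms)

lemma Ck_on_cong:
  assumes "open S" "\<And>y. y \<in> S \<Longrightarrow> f y = g y" "Ck_on k f S"
  shows "Ck_on k g S"
  using assms
proof (induction k arbitrary: f g)
  case 0
  then show ?case using Ck_on_0 continuous_on_cong by metis
next
  case (Suc k)
  have 1: "continuous_on S g" using Suc.prems Ck_on_imp_continuous continuous_on_cong by metis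
  have F: "Ck_on k (partial_deriv i f) S" "\<forall>x\<in>S. has_partial i f x (partial_deriv i f x)" for i
    using Suc.prems(3) by (auto simp: Ck_on_Suc)
  have e: "partial_deriv i f x = partial_deriv i g x" if "x \<in> S" for i x
    by (rule partial_deriv_cong[OF Suc.prems(1) that Suc.prems(2)])
  have 2: "Ck_on k (partial_deriv i g) S" for i
    by (rule Suc.IH[OF Suc.prems(1) e F(1)])
  have "has_partial i g x (partial_deriv i g x)" if "x \<in> S" for i x
    using F(2) that e[OF that] has_partial_cong[OF Suc.prems(1) that Suc.prems(2)] by fastforce
  with 1 2 show ?case by (simp add: Ck_on_Suc)
qed

text \<open>On an open set the supplied \<open>f'\<close> agrees with \<open>partial_deriv\<close>
  and regularity is local, so explicit formulas for the derivatives suffice.\<close>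

lemma Ck_on_SucI:
  assumes "open S" "continuous_on S f"
    and "\<And>i x. x \<in> S \<Longrightarrow> has_partial i f x (f' i x)" "\<And>i. Ck_on k (f' i) S"
  shows "Ck_on (Suc k) f S"
  unfolding Ck_on_Suc
proof (intro conjI allI ballI)
  fix i
  show "Ck_on k (partial_deriv i f) S"
    by (rule Ck_on_cong[OF assms(1) _ assms(4)[of i]])
      (use assms(3) has_partial_partial_deriv in metis)
  show "has_partial i f x (partial_deriv i f x)" if "x \<in> S" for x
    using assms(3) that has_partial_partial_deriv by metis
qed fact

text \<open>Serves to glue a function that is smooth near its support to the zero function
  outside.\<close>

lemma Ck_on_Un:
  assumes "open S" "open T" "Ck_on k f S" "Ck_on k f T"
  shows "Ck_on k f (S \<union> T)"
  using assms(3,4) unfolding Ck_on_def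
  by (auto intro!: continuous_on_open_Un assms)

section \<open>Closure of C^k under algebraic operations\<close>

lemma has_partial_const: "has_partial i (\<lambda>x. c) x 0"
  unfolding has_partial_def by simp

lemma has_partial_add:
  "has_partial i f x D \<Longrightarrow> has_partial i g x E \<Longrightarrow> has_partial i (\<lambda>x. f x + g x) x (D + E)"
  unfolding has_partial_def by (rule DERIV_add)

lemma has_partial_mult:
  "has_partial i f x D \<Longrightarrow> has_partial i g x E \<Longrightarrow> has_partial i (\<lambda>x. f x * g x) x (D * g x + E * f x)"
  unfolding has_partial_def using DERIV_mult by fastforce

lemma has_partial_compose:
  assumes "has_partial i f x D" "(h has_real_derivative h') (at (f x))"
  shows "has_partial i (\<lambda>x. h (f x)) x (h' * D)"
  using assms DERIV_chain2[of h h' "\<lambda>t. f (x + t *\<^sub>R axis i 1)" 0 D]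
  unfolding has_partial_def by simp

lemma Ck_on_const:
  assumes "open S" shows "Ck_on k (\<lambda>x. c) S"
proof (induction k arbitrary: c)
  case 0
  then show ?case by (simp add: Ck_on_0)
next
  case (Suc k)
  then show ?case
    by (intro Ck_on_SucI[where f' = "\<lambda>i x. 0"] assms has_partial_const) auto
qed

lemma Ck_on_component:
  assumes "open S" shows "Ck_on k (\<lambda>x. x $ j) S"
proof (cases k)
  case 0
  then show ?thesis by (simp add: Ck_on_0 continuous_on_component)
next
  case (Suc l)
  have "has_partial i (\<lambda>x. x $ j) x (if i = j then 1 else 0)" for i x
    unfolding has_partial_def
    by (auto simp: axis_def intro!: derivative_eq_intros)
  then show ?thesis unfolding Suc
    by (intro Ck_on_SucI[where f' = "\<lambda>i x. if i = j then 1 else 0"] Ck_on_const assms)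
      (auto intro: continuous_on_component)
qed

lemma Ck_on_add:
  assumes "open S" "Ck_on k f S" "Ck_on k g S"
  shows "Ck_on k (\<lambda>x. f x + g x) S"
  using assms(2,3)
proof (induction k arbitrary: f g)
  case 0
  then show ?case by (simp add: Ck_on_0 continuous_on_add)
next
  case (Suc k)
  then show ?case
    by (intro Ck_on_SucI[where f' = "\<lambda>i x. partial_deriv i f x + partial_deriv i g x"] assms has_partial_add)
      (auto simp: Ck_on_Suc intro!: continuous_intros)
qed

lemma Ck_on_mult:
  assumes "open S" "Ck_on k f S" "Ck_on k g S"
  shows "Ck_on k (\<lambda>x. f x * g x) S"
  using assms(2,3)
proof (induction k arbitrary: f g)
  case 0
  then show ?case by (simp add: Ck_on_0 continuous_on_mult)
next
  case (Suc k)
  have "Ck_on k f S" "Ck_on k g S" using Suc.prems Ck_on_mono by (blast intro: le_SucI)+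
  with Suc show ?case
    by (intro Ck_on_SucI[where f' = "\<lambda>i x. partial_deriv i f x * g x + partial_deriv i g x * f x"]
        assms has_partial_mult Ck_on_add)
      (auto simp: Ck_on_Suc intro!: continuous_intros)
qed

lemma Ck_on_sum:
  assumes "open S" "\<And>j. j \<in> J \<Longrightarrow> Ck_on k (f j) S"
  shows "Ck_on k (\<lambda>x. \<Sum>j\<in>J. f j x) S"
  using assms(2)
proof (induction J rule: infinite_finite_induct)
  case (insert j J)
  then show ?case by (simp add: Ck_on_add assms)
qed (simp_all add: Ck_on_const assms)

section \<open>Composition with one-variable profiles\<close>

primrec CkR :: "nat \<Rightarrow> (real \<Rightarrow> real) \<Rightarrow> real set \<Rightarrow> bool" where
  "CkR 0 h T \<longleftrightarrow> continuous_on T h"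
| "CkR (Suc k) h T \<longleftrightarrow> (\<exists>h'. (\<forall>t\<in>T. (h has_real_derivative h' t) (at t)) \<and> CkR k h' T)"

text \<open>The chain rule produces a product with \<open>h' (f x)\<close> as a factor, which the
  induction hypothesis covers because \<open>h\<close> is generalised.\<close>

lemma Ck_on_compose:
  assumes "open S" "Ck_on k f S" "CkR k h T" "\<And>x. x \<in> S \<Longrightarrow> f x \<in> T"
  shows "Ck_on k (\<lambda>x. h (f x)) S"
  using assms(2,3)
proof (induction k arbitrary: h)
  case 0
  then show ?case
    using continuous_on_compose2[of T h S f] assms(4) by (auto simp: Ck_on_0)
next
  case (Suc k)
  obtain h' where h': "\<And>t. t \<in> T \<Longrightarrow> (h has_real_derivative h' t) (at t)" "CkR k h' T"
    using Suc.prems by auto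
  have "continuous_on T h"
    by (rule DERIV_continuous_on) (use h'(1) has_field_derivative_at_within in blast)
  then have "continuous_on S (\<lambda>x. h (f x))"
    using continuous_on_compose2[of T h S f] assms(4) Ck_on_imp_continuous[OF Suc.prems(1)] by auto
  moreover have "Ck_on k f S" using Suc.prems Ck_on_mono by (blast intro: le_SucI)
  ultimately show ?case using Suc h' assms(4)
    by (intro Ck_on_SucI[where f' = "\<lambda>i x. h' (f x) * partial_deriv i f x"] assms(1)
        has_partial_compose Ck_on_mult)
      (auto simp: Ck_on_Suc)
qed

lemma CkR_scale: "CkR k h T \<Longrightarrow> CkR k (\<lambda>t. c * h t) T"
proof (induction k arbitrary: h)
  case 0
  then show ?case by (auto intro!: continuous_intros)
next
  case (Suc k)
  then obtain h' where h': "\<And>t. t \<in> T \<Longrightarrow> (h has_real_derivative h' t) (at t)" "CkR k h' T"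
    by auto
  show ?case using h' Suc.IH[OF h'(2)]
    by (auto intro!: exI[of _ "\<lambda>t. c * h' t"] DERIV_cmult)
qed

lemma CkR_powr: "CkR k (\<lambda>t. t powr a) {0<..}"
proof (induction k arbitrary: a)
  case 0
  then show ?case by (auto intro!: continuous_intros)
next
  case (Suc k)
  show ?case
    using CkR_scale[OF Suc, of a "a - 1"]
    by (auto intro!: exI[of _ "\<lambda>t. a * t powr (a - 1)"] derivative_eq_intros)
qed

lemma CkR_power: "CkR k (\<lambda>t. t ^ N) UNIV"
proof (induction k arbitrary: N)
  case 0
  then show ?case by (auto intro!: continuous_intros)
next
  case (Suc k)
  show ?case
    using CkR_scale[OF Suc, of "real N" "N - 1"]
    by (auto intro!: exI[of _ "\<lambda>t. real N * t ^ (N - 1)"] derivative_eq_intros)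
qed

text \<open>An exponent of at least two makes the derivative vanish at the kink: the difference
  quotient there is at most |h|^(N+1).\<close>

lemma DERIV_pos_part_power:
  "((\<lambda>t::real. max 0 t ^ (N + 2)) has_real_derivative real (N + 2) * max 0 t ^ (N + 1)) (at t)"
proof -
  consider "t < 0" | "t = 0" | "t > 0" by linarith
  then show ?thesis
  proof cases
    case 1
    have "((\<lambda>t::real. 0) has_real_derivative 0) (at t)" by simp
    moreover have "eventually (\<lambda>t::real. 0 = max 0 t ^ (N + 2)) (nhds t)"
      using eventually_nhds_in_open[of "{..<0}" t] 1 by (auto elim!: eventually_mono)
    ultimately show ?thesis using 1
      using DERIV_cong_ev[of t t "\<lambda>t. 0" "\<lambda>t. max 0 t ^ (N + 2)" 0 0] by simp
  next
    case 2
    have "((\<lambda>h::real. max 0 h ^ (N + 2) / h) \<longlongrightarrow> 0) (at 0)"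
    proof (rule Lim_null_comparison[of _ "\<lambda>h. \<bar>h\<bar> ^ (N + 1)"])
      show "\<forall>\<^sub>F h::real in at 0. norm (max 0 h ^ (N + 2) / h) \<le> \<bar>h\<bar> ^ (N + 1)"
      proof (intro always_eventually allI)
        show "norm (max 0 h ^ (N + 2) / h) \<le> \<bar>h\<bar> ^ (N + 1)" for h :: real
        proof (cases "h \<le> 0")
          case True
          then have "norm (max 0 h ^ (N + 2) / h) = 0" by (simp add: max_absorb1)
          also have "0 \<le> \<bar>h\<bar> ^ (N + 1)" by (rule zero_le_power) simp
          finally show ?thesis .
        qed auto
      qed
      have "((\<lambda>h::real. \<bar>h\<bar> ^ (N + 1)) \<longlongrightarrow> \<bar>0\<bar> ^ (N + 1)) (at 0)"
        by (intro tendsto_intros)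
      then show "((\<lambda>h::real. \<bar>h\<bar> ^ (N + 1)) \<longlongrightarrow> 0) (at 0)" by simp
    qed
    then show ?thesis using 2 by (simp add: DERIV_def)
  next
    case 3
    have "((\<lambda>t::real. t ^ (N + 2)) has_real_derivative real (N + 2) * t ^ (N + 1)) (at t)"
      using DERIV_pow[of "N + 2" t] by simp
    moreover have "eventually (\<lambda>t::real. t ^ (N + 2) = max 0 t ^ (N + 2)) (nhds t)"
      using eventually_nhds_in_open[of "{0<..}" t] 3 by (auto elim!: eventually_mono)
    ultimately show ?thesis using 3
      using DERIV_cong_ev[of t t "\<lambda>t. t ^ (N + 2)" "\<lambda>t. max 0 t ^ (N + 2)" "real (N + 2) * t ^ (N + 1)" "real (N + 2) * t ^ (N + 1)"] by simp
  qed
qed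

text \<open>Each differentiation costs one power and at least one must remain. Hence the exponent
  \<open>2 * m + 1\<close> in the truncations below, which have to be C^(2m).\<close>

lemma CkR_pos_part_power: "k < N \<Longrightarrow> CkR k (\<lambda>t. max 0 t ^ N) UNIV"
proof (induction k arbitrary: N)
  case 0
  then show ?case by (auto intro!: continuous_intros)
next
  case (Suc k)
  define M where "M = N - 2"
  then have M: "N = M + 2" using Suc.prems by simp
  have "CkR k (\<lambda>t. max 0 t ^ (M + 1)) UNIV"
    by (rule Suc.IH) (use Suc.prems M in simp)
  from CkR_scale[OF this, of "real (M + 2)"] DERIV_pos_part_power[of M] show ?case unfolding M CkR.simps
    by (intro exI[of _ "\<lambda>t. real (M + 2) * max 0 t ^ (M + 1)"]) simp
qed

section \<open>Locality and linearity of the iterated Laplacian\<close>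

lemma laplacian_cong:
  assumes "open S" "x \<in> S" "\<And>y. y \<in> S \<Longrightarrow> f y = g y"
  shows "laplacian f x = laplacian g x"
  unfolding laplacian_def
  using assms by (intro sum.cong refl partial_deriv_cong[of S]) auto

lemma laplacian_funpow_cong:
  assumes "open S" "x \<in> S" "\<And>y. y \<in> S \<Longrightarrow> f y = g y"
  shows "(laplacian ^^ m) f x = (laplacian ^^ m) g x"
  using assms(2)
proof (induction m arbitrary: x)
  case 0
  then show ?case using assms by simp
next
  case (Suc m)
  have "laplacian ((laplacian ^^ m) f) x = laplacian ((laplacian ^^ m) g) x"
    by (rule laplacian_cong[OF assms(1) Suc.prems Suc.IH])
  then show ?case by simp
qed

lemma Ck_on_partial_deriv2:
  "Ck_on (Suc (Suc k)) f S \<Longrightarrow> Ck_on k (partial_deriv i (partial_deriv i f)) S"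
  by (auto simp: Ck_on_Suc)

lemma Ck_on_laplacian:
  assumes "open S" "Ck_on (Suc (Suc k)) f S"
  shows "Ck_on k (laplacian f) S"
  unfolding laplacian_def[abs_def]
  by (intro Ck_on_sum assms Ck_on_partial_deriv2)

lemma Ck_on_laplacian_funpow:
  assumes "open S" "Ck_on (k + 2 * m) f S"
  shows "Ck_on k ((laplacian ^^ m) f) S"
  using assms(2)
proof (induction m arbitrary: k)
  case (Suc m)
  then have "Ck_on (Suc (Suc k)) ((laplacian ^^ m) f) S" by simp
  then show ?case using Ck_on_laplacian[OF assms(1)] by auto
qed auto

text \<open>The regularity assumptions supply the existence of the derivatives: \<open>deriv\<close>
  need not be additive where they fail to exist.\<close>

lemma laplacian_lincomb2:
  assumes "open S" "Ck_on 2 f S" "Ck_on 2 g S" "x \<in> S"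
  shows "laplacian (\<lambda>x. c * f x + g x) x = c * laplacian f x + laplacian g x"
proof -
  have 1: "partial_deriv i (\<lambda>x. c * f x + g x) y = c * partial_deriv i f y + partial_deriv i g y"
    if "Ck_on 1 f S" "Ck_on 1 g S" "y \<in> S" for i y and f g
  proof (rule has_partial_partial_deriv)
    have "has_partial i f y (partial_deriv i f y)" "has_partial i g y (partial_deriv i g y)"
      using that by (auto simp: Ck_on_Suc)
    from has_partial_add[OF has_partial_mult[OF has_partial_const[of i c y] this(1)] this(2)]
    show "has_partial i (\<lambda>x. c * f x + g x) y (c * partial_deriv i f y + partial_deriv i g y)"
      by (simp add: mult.commute)
  qed
  have d: "Ck_on 1 f S" "Ck_on 1 g S"
    using assms(2,3) Ck_on_mono[of 2 _ S 1] by simp_all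
  have d': "\<And>i. Ck_on 1 (partial_deriv i f) S" "\<And>i. Ck_on 1 (partial_deriv i g) S"
    using assms(2,3) Ck_on_Suc[of 1 _ S] unfolding Suc_1 by blast+
  have "partial_deriv i (partial_deriv i (\<lambda>x. c * f x + g x)) x
    = c * partial_deriv i (partial_deriv i f) x + partial_deriv i (partial_deriv i g) x" for i
  proof -
    have "partial_deriv i (partial_deriv i (\<lambda>x. c * f x + g x)) x
      = partial_deriv i (\<lambda>x. c * partial_deriv i f x + partial_deriv i g x) x"
      by (rule partial_deriv_cong[OF assms(1,4) 1[OF d]])
    also have "\<dots> = c * partial_deriv i (partial_deriv i f) x + partial_deriv i (partial_deriv i g) x"
      by (rule 1[OF d' assms(4)])
    finally show ?thesis .
  qed
  then show ?thesis by (simp add: laplacian_def sum.distrib sum_distrib_left)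
qed

lemma laplacian_funpow_lincomb2:
  assumes "open S" "Ck_on (2 * m) f S" "Ck_on (2 * m) g S" "x \<in> S"
  shows "(laplacian ^^ m) (\<lambda>x. c * f x + g x) x = c * (laplacian ^^ m) f x + (laplacian ^^ m) g x"
  using assms(2-4)
proof (induction m arbitrary: x)
  case (Suc m)
  have d: "Ck_on (2 * m) f S" "Ck_on (2 * m) g S"
    using Suc.prems Ck_on_mono by (metis Suc_1 add_2_eq_Suc le_add2 mult_Suc_right)+
  have c: "Ck_on 2 ((laplacian ^^ m) f) S" "Ck_on 2 ((laplacian ^^ m) g) S"
    by (rule Ck_on_laplacian_funpow[OF assms(1)], use Suc.prems in simp)+
  have "laplacian ((laplacian ^^ m) (\<lambda>x. c * f x + g x)) x
    = laplacian (\<lambda>x. c * (laplacian ^^ m) f x + (laplacian ^^ m) g x) x"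
    by (rule laplacian_cong[OF assms(1) Suc.prems(3)]) (use Suc.IH d in auto)
  then show ?case using laplacian_lincomb2[OF assms(1) c Suc.prems(3)] by simp
qed auto

lemma laplacian_funpow_sum:
  assumes "open S" "finite J" "\<And>j. j \<in> J \<Longrightarrow> Ck_on (2 * m) (f j) S" "x \<in> S"
  shows "(laplacian ^^ m) (\<lambda>x. \<Sum>j\<in>J. c j * f j x) x = (\<Sum>j\<in>J. c j * (laplacian ^^ m) (f j) x)"
  using assms(2,3)
proof (induction J)
  case empty
  \<comment> \<open>The zero function by linearity: (-1) * 0 + 0 is again zero, so its image equals
    minus itself plus itself.\<close>
  have "(laplacian ^^ m) (\<lambda>x. (-1) * (\<lambda>x. 0) x + (\<lambda>x. 0) x) x = (-1) * (laplacian ^^ m) (\<lambda>x. 0) x + (laplacian ^^ m) (\<lambda>x. 0) x"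
    by (rule laplacian_funpow_lincomb2[OF assms(1)]) (auto intro: Ck_on_const assms)
  then show ?case by simp
next
  case (insert j J)
  have "Ck_on (2 * m) (\<lambda>x. \<Sum>j\<in>J. c j * f j x) S"
    by (intro Ck_on_sum Ck_on_mult Ck_on_const assms(1)) (use insert.prems in auto)
  from laplacian_funpow_lincomb2[OF assms(1) _ this assms(4), of "f j" "c j"] insert
  show ?case by simp
qed

subsection \<open>Green's formula\<close>

lemma integrable_compact_support:
  fixes f :: "'a::euclidean_space \<Rightarrow> real"
  assumes "compact K" "continuous_on K f" "\<And>x. x \<notin> K \<Longrightarrow> f x = 0"
  shows "integrable lborel f"
proof -
  have "(\<lambda>x. indicator K x *\<^sub>R f x) = f"
    using assms(3) by (auto simp: fun_eq_iff indicator_def)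
  then show ?thesis using borel_integrable_compact[OF assms(1,2)] by simp
qed

lemma partial_deriv_zero_off:
  assumes "closed K" "\<And>x. x \<notin> K \<Longrightarrow> f x = 0" "x \<notin> K"
  shows "partial_deriv i f x = 0"
proof -
  have "partial_deriv i f x = partial_deriv i (\<lambda>x. 0) x"
    by (rule partial_deriv_cong[of "- K"]) (use assms in auto)
  then show ?thesis using has_partial_partial_deriv[OF has_partial_const] by simp
qed

lemma laplacian_zero_off:
  assumes "closed K" "\<And>x. x \<notin> K \<Longrightarrow> f x = 0" "x \<notin> K"
  shows "laplacian f x = 0"
  unfolding laplacian_def
  using partial_deriv_zero_off[OF assms(1) partial_deriv_zero_off[OF assms(1,2)] assms(3)]
  by (simp add: sum.neutral)

lemma laplacian_funpow_zero_off:
  assumes "closed K" "\<And>x. x \<notin> K \<Longrightarrow> f x = 0" "x \<notin> K"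
  shows "(laplacian ^^ m) f x = 0"
  using assms(3)
proof (induction m arbitrary: x)
  case (Suc m)
  have "laplacian ((laplacian ^^ m) f) x = 0"
    by (rule laplacian_zero_off[OF assms(1) Suc.IH Suc.prems])
  then show ?case by simp
qed (use assms in auto)

lemma has_partial_shift:
  assumes "has_partial i f (x + s *\<^sub>R axis i 1) D"
  shows "((\<lambda>t. f (x + t *\<^sub>R axis i 1)) has_real_derivative D) (at s)"
proof -
  have "((\<lambda>h. f (x + (h + s) *\<^sub>R axis i 1)) has_real_derivative D) (at 0)"
    using assms unfolding has_partial_def by (simp add: scaleR_add_left algebra_simps)
  then show ?thesis
    using DERIV_shift[of "\<lambda>t. f (x + t *\<^sub>R axis i 1)" D 0 s] by simp
qed

text \<open>The difference quotients have integral zero by translation invariance; dominated convergence then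
  avoids any use of Fubini.\<close>

lemma integral_partial_deriv_eq_0:
  fixes F :: "real^'n::finite \<Rightarrow> real"
  assumes F: "Ck_on 1 F UNIV" and K: "compact K" and F0: "\<And>x. x \<notin> K \<Longrightarrow> F x = 0"
  shows "integral\<^sup>L lborel (partial_deriv i F) = 0"
proof -
  define e :: "real^'n" where "e = axis i 1"
  define F' where "F' = partial_deriv i F"
  have ne: "norm e = 1" by (simp add: e_def)
  have cF: "continuous_on UNIV F" using F Ck_on_imp_continuous by blast
  have cF': "continuous_on UNIV F'" and dF: "\<And>x. has_partial i F x (F' x)"
    using F Ck_on_Suc[of 0 F UNIV] by (auto simp: F'_def Ck_on_0)
  have F'0: "x \<notin> K \<Longrightarrow> F' x = 0" for x
    unfolding F'_def by (rule partial_deriv_zero_off[OF compact_imp_closed[OF K] F0])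
  obtain B where B: "B > 0" "\<And>x. x \<in> K \<Longrightarrow> \<bar>F' x\<bar> \<le> B"
  proof -
    have "bounded (F' ` K)"
      by (intro compact_imp_bounded compact_continuous_image continuous_on_subset[OF cF'] K) auto
    then show ?thesis using that bounded_pos[of "F' ` K"] by auto
  qed
  then have B': "\<bar>F' x\<bar> \<le> B" for x using F'0[of x] by (cases "x \<in> K") auto
  \<comment> \<open>The unit neighbourhood of K contains the supports of all difference quotients
    \<open>q k\<close>, because the steps \<open>t k\<close> are at most 1.\<close>
  define K1 where "K1 = {x + y |x y. x \<in> K \<and> y \<in> cball 0 1}"
  have K1: "compact K1" unfolding K1_def by (intro compact_sums K compact_cball)
  define t :: "nat \<Rightarrow> real" where "t k = 1 / real (Suc k)" for k
  have t: "0 < t k" "t k \<le> 1" for k by (auto simp: t_def)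
  define q where "q k x = (F (x + t k *\<^sub>R e) - F x) / t k" for k x
  have Fint: "integrable lborel F"
    by (rule integrable_compact_support[OF K _ F0]) (use cF continuous_on_subset in blast)
  have tr: "integrable lborel (\<lambda>x. F (x + c))" "integral\<^sup>L lborel (\<lambda>x. F (x + c)) = integral\<^sup>L lborel F" for c
  proof -
    have mF: "F \<in> borel_measurable lborel" using Fint by auto
    have "integrable (distr lborel borel ((+) c)) F" using Fint lborel_distr_plus by metis
    then have "integrable lborel (\<lambda>x. F (c + x))"
      by (subst (asm) integrable_distr_eq) (use mF in auto)
    then show "integrable lborel (\<lambda>x. F (x + c))" by (simp add: add.commute)
    have "integral\<^sup>L (distr lborel borel ((+) c)) F = integral\<^sup>L lborel (\<lambda>x. F (c + x))"
      by (subst integral_distr) (use mF in auto)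
    then show "integral\<^sup>L lborel (\<lambda>x. F (x + c)) = integral\<^sup>L lborel F"
      by (simp add: add.commute lborel_distr_plus)
  qed
  have q0: "integral\<^sup>L lborel (q k) = 0" for k
  proof -
    have "integral\<^sup>L lborel (q k) = integral\<^sup>L lborel (\<lambda>x. F (x + t k *\<^sub>R e) - F x) / t k"
      unfolding q_def by simp
    also have "integral\<^sup>L lborel (\<lambda>x. F (x + t k *\<^sub>R e) - F x) = 0"
      using tr Fint by (subst Bochner_Integration.integral_diff) auto
    finally show ?thesis by simp
  qed
  have qb: "\<bar>q k x\<bar> \<le> B * indicator K1 x" for k x
  proof (cases "x \<in> K1")
    case True
    \<comment> \<open>By the mean value theorem the quotient is a value of \<open>F'\<close>, hence
      bounded by B uniformly in k; this gives the dominating function.\<close>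
    have "\<exists>s. 0 < s \<and> s < t k \<and> F (x + t k *\<^sub>R e) - F (x + 0 *\<^sub>R e) = (t k - 0) * F' (x + s *\<^sub>R e)"
      by (rule MVT2) (use t[of k] has_partial_shift[OF dF] in \<open>auto simp: e_def\<close>)
    then obtain s where "F (x + t k *\<^sub>R e) - F x = t k * F' (x + s *\<^sub>R e)" by auto
    then have "q k x = F' (x + s *\<^sub>R e)" using t[of k] by (simp add: q_def)
    then show ?thesis using B' True by simp
  next
    case False
    have "x \<notin> K" using False by (auto simp: K1_def intro: exI[of _ x] exI[of _ 0])
    moreover have "x + t k *\<^sub>R e \<notin> K"
    proof
      assume "x + t k *\<^sub>R e \<in> K"
      moreover have "x = (x + t k *\<^sub>R e) + (- (t k *\<^sub>R e))" by simp
      moreover have "- (t k *\<^sub>R e) \<in> cball 0 1" using t[of k] ne by simp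
      ultimately show False using False unfolding K1_def by blast
    qed
    ultimately show ?thesis using F0 by (simp add: q_def False)
  qed
  have qlim: "(\<lambda>k. q k x) \<longlonglongrightarrow> F' x" for x
  proof -
    have "(\<lambda>h. (F (x + (0 + h) *\<^sub>R e) - F (x + 0 *\<^sub>R e)) / h) \<midarrow>0\<rightarrow> F' x"
      using dF[of x] unfolding has_partial_def DERIV_def e_def .
    moreover have "filterlim t (at 0) sequentially"
    proof (subst filterlim_at, intro conjI)
      show "t \<longlonglongrightarrow> 0" unfolding t_def using LIMSEQ_inverse_real_of_nat by (simp add: inverse_eq_divide)
      show "\<forall>\<^sub>F k in sequentially. t k \<in> UNIV \<and> t k \<noteq> 0"
        using t by (auto intro!: always_eventually simp: less_imp_neq[symmetric])
    qed
    ultimately have "((\<lambda>h. (F (x + (0 + h) *\<^sub>R e) - F (x + 0 *\<^sub>R e)) / h) \<circ> t) \<longlonglongrightarrow> F' x"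
      unfolding comp_def by (rule filterlim_compose)
    then show ?thesis by (simp add: q_def comp_def)
  qed
  have "(\<lambda>k. integral\<^sup>L lborel (q k)) \<longlonglongrightarrow> integral\<^sup>L lborel F'"
  proof (rule integral_dominated_convergence[where w = "\<lambda>x. B * indicator K1 x"])
    show "F' \<in> borel_measurable lborel"
      using borel_measurable_continuous_onI[OF cF'] by simp
    show "q k \<in> borel_measurable lborel" for k
      unfolding q_def using tr(1) Fint by measurable
    show "integrable lborel (\<lambda>x. B * indicator K1 x)"
    proof (rule integrable_compact_support[OF K1])
      show "continuous_on K1 (\<lambda>x. B * indicator K1 x)"
        by (rule continuous_on_eq[of _ "\<lambda>x. B"]) auto
    qed auto
  qed (use qlim qb in auto)
  then show ?thesis unfolding F'_def q0 by (simp add: LIMSEQ_const_iff)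
qed

section \<open>Gluing with zero and Green's identity\<close>

lemma Ck_on_zero_off:
  assumes "closed K" "\<And>x. x \<notin> K \<Longrightarrow> f x = 0"
  shows "Ck_on k f (- K)"
  by (rule Ck_on_cong[of "- K" "\<lambda>x. 0"]) (use assms Ck_on_const[of "- K"] in auto)

text \<open>S and the complement of K are open and cover the space, and on the latter the function
  is zero.\<close>

lemma Ck_on_UNIV_zero_off:
  assumes "open S" "K \<subseteq> S" "closed K" "\<And>x. x \<notin> K \<Longrightarrow> f x = 0" "Ck_on k f S"
  shows "Ck_on k f UNIV"
proof -
  have "Ck_on k f (S \<union> - K)"
    using assms by (intro Ck_on_Un Ck_on_zero_off) auto
  moreover have "S \<union> - K = UNIV" using assms by auto
  ultimately show ?thesis by simp
qed

text \<open>The difference of the two integrands is a sum of i-th partial derivatives of compactly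
  supported C^1 functions, each of integral zero. Since \<phi> vanishes off K, the values of u
  outside S do not matter.\<close>

lemma green_formula:
  fixes u \<phi> :: "real^'n::finite \<Rightarrow> real"
  assumes S: "open S" and u: "Ck_on 2 u S" and \<phi>: "Ck_on 2 \<phi> UNIV"
    and K: "compact K" "K \<subseteq> S" and \<phi>0: "\<And>x. x \<notin> K \<Longrightarrow> \<phi> x = 0"
  shows "integral\<^sup>L lborel (\<lambda>x. u x * laplacian \<phi> x) = integral\<^sup>L lborel (\<lambda>x. \<phi> x * laplacian u x)"
proof -
  have cl: "closed K" using K compact_imp_closed by blast
  have \<phi>S: "Ck_on 2 \<phi> S" using \<phi> Ck_on_subset by blast
  \<comment> \<open>\<open>p i\<close> is the i-th component of the Green vector field and
    \<open>r i\<close> its i-th derivative, in which the mixed first-order products cancel.\<close>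
  define p where "p i x = u x * partial_deriv i \<phi> x + (- 1) * (\<phi> x * partial_deriv i u x)" for i x
  define r where "r i x = u x * partial_deriv i (partial_deriv i \<phi>) x - \<phi> x * partial_deriv i (partial_deriv i u) x" for i x
  have d: "Ck_on 1 u S" "Ck_on 1 \<phi> S"
    using u \<phi>S Ck_on_mono[of 2 _ S 1] by simp_all
  have d': "Ck_on 1 (partial_deriv i u) S" "Ck_on 1 (partial_deriv i \<phi>) S" for i
    using u \<phi>S Ck_on_Suc[of 1 _ S] unfolding Suc_1 by blast+
  have p1: "Ck_on 1 (p i) S" for i
    unfolding p_def by (intro Ck_on_add Ck_on_mult Ck_on_const d d' S)
  have z1: "partial_deriv i \<phi> x = 0" if "x \<notin> K" for i x
    using partial_deriv_zero_off[OF cl \<phi>0 that] .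
  have z2: "partial_deriv i (partial_deriv i \<phi>) x = 0" if "x \<notin> K" for i x
    by (rule partial_deriv_zero_off[OF cl z1 that])
  have p0: "p i x = 0" if "x \<notin> K" for i x
    using z1 \<phi>0 that by (simp add: p_def)
  have pU: "Ck_on 1 (p i) UNIV" for i
    by (rule Ck_on_UNIV_zero_off[OF S K(2) cl p0 p1])
  have pr: "partial_deriv i (p i) x = r i x" for i x
  proof (cases "x \<in> K")
    case True
    then have x: "x \<in> S" using K by auto
    have h: "has_partial i u x (partial_deriv i u x)" "has_partial i \<phi> x (partial_deriv i \<phi> x)"
      "has_partial i (partial_deriv i u) x (partial_deriv i (partial_deriv i u) x)"
      "has_partial i (partial_deriv i \<phi>) x (partial_deriv i (partial_deriv i \<phi>) x)"
      using d d' x Ck_on_Suc[of 0 _ S] by auto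
    show ?thesis
      unfolding p_def
      by (rule has_partial_partial_deriv)
        (use has_partial_add[OF has_partial_mult[OF h(1,4)]
          has_partial_mult[OF has_partial_const[of i "-1"] has_partial_mult[OF h(2,3)]]]
          in \<open>simp add: r_def algebra_simps\<close>)
  next
    case False
    have "partial_deriv i (p i) x = 0" by (rule partial_deriv_zero_off[OF cl p0 False])
    then show ?thesis using z2 \<phi>0 False by (simp add: r_def)
  qed
  have c2: "continuous_on K (partial_deriv i (partial_deriv i u))"
    "continuous_on K (partial_deriv i (partial_deriv i \<phi>))" "continuous_on K u" "continuous_on K \<phi>" for i
    using Ck_on_partial_deriv2[of 0 _ S i] u \<phi>S K(2) d[THEN Ck_on_imp_continuous] continuous_on_subset
    unfolding numeral_2_eq_2 Ck_on_0 by blast+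
  have i1: "integrable lborel (\<lambda>x. u x * partial_deriv i (partial_deriv i \<phi>) x)" for i
    by (rule integrable_compact_support[OF K(1)]) (use z2 c2 in \<open>auto intro!: continuous_intros\<close>)
  have i2: "integrable lborel (\<lambda>x. \<phi> x * partial_deriv i (partial_deriv i u) x)" for i
    by (rule integrable_compact_support[OF K(1)]) (use \<phi>0 c2 in \<open>auto intro!: continuous_intros\<close>)
  have "integral\<^sup>L lborel (r i) = 0" for i
    using integral_partial_deriv_eq_0[OF pU K(1) p0, of i] pr by (metis (no_types, lifting) ext)
  then have e: "integral\<^sup>L lborel (\<lambda>x. u x * partial_deriv i (partial_deriv i \<phi>) x)
    = integral\<^sup>L lborel (\<lambda>x. \<phi> x * partial_deriv i (partial_deriv i u) x)" for i
    unfolding r_def using i1 i2 by (simp add: Bochner_Integration.integral_diff)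
  show ?thesis
    unfolding laplacian_def sum_distrib_left
    using i1 i2 e by (simp add: Bochner_Integration.integral_sum)
qed

text \<open>One Laplacian is moved at a time: the induction hypothesis is applied to \<Delta>\<phi>,
  then Green's formula to \<Delta>^m u and \<phi>.\<close>

lemma green_formula_iter:
  fixes u \<phi> :: "real^'n::finite \<Rightarrow> real"
  assumes S: "open S" and u: "Ck_on (2 * m) u S" and \<phi>: "Ck_on (2 * m) \<phi> UNIV"
    and K: "compact K" "K \<subseteq> S" and \<phi>0: "\<And>x. x \<notin> K \<Longrightarrow> \<phi> x = 0"
  shows "integral\<^sup>L lborel (\<lambda>x. u x * (laplacian ^^ m) \<phi> x)
    = integral\<^sup>L lborel (\<lambda>x. \<phi> x * (laplacian ^^ m) u x)"
  using u \<phi> \<phi>0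
proof (induction m arbitrary: \<phi>)
  case (Suc m)
  have cl: "closed K" using K compact_imp_closed by blast
  have u1: "Ck_on (2 * m) u S" using Suc.prems(1) Ck_on_mono[of "2 * Suc m" u S "2 * m"] by simp
  have u2: "Ck_on 2 ((laplacian ^^ m) u) S"
    by (rule Ck_on_laplacian_funpow[OF S]) (use Suc.prems in simp)
  have \<phi>2: "Ck_on 2 \<phi> UNIV" using Suc.prems(2) Ck_on_mono[of "2 * Suc m" \<phi> UNIV "2"] by simp
  have \<phi>1: "Ck_on (2 * m) (laplacian \<phi>) UNIV"
    by (rule Ck_on_laplacian) (use Suc.prems in auto)
  have "integral\<^sup>L lborel (\<lambda>x. u x * (laplacian ^^ m) (laplacian \<phi>) x)
    = integral\<^sup>L lborel (\<lambda>x. laplacian \<phi> x * (laplacian ^^ m) u x)"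
    by (rule Suc.IH[OF u1 \<phi>1 laplacian_zero_off[OF cl Suc.prems(3)]])
  also have "\<dots> = integral\<^sup>L lborel (\<lambda>x. (laplacian ^^ m) u x * laplacian \<phi> x)"
    by (simp add: mult.commute)
  also have "\<dots> = integral\<^sup>L lborel (\<lambda>x. \<phi> x * laplacian ((laplacian ^^ m) u) x)"
    by (rule green_formula[OF S u2 \<phi>2 K Suc.prems(3)])
  finally show ?case by (simp only: funpow_Suc_right funpow.simps comp_apply flip: funpow_Suc_right) (simp add: funpow_swap1)
qed (simp add: mult.commute)

subsection \<open>Iterated Laplacians of radial functions\<close>

text \<open>The parameter \<open>e\<close> stands for \<epsilon>^2 in the overview;
  \<open>sq 0 0\<close> is the squared norm. Squares keep the function polynomial, hence smooth
  everywhere.\<close>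

definition sq :: "real^'n::finite \<Rightarrow> real \<Rightarrow> real^'n \<Rightarrow> real" where
  "sq z e x = (norm (x - z))\<^sup>2 + e"

lemma sq_alt: "sq z e x = (\<Sum>i\<in>UNIV. (x $ i + - z $ i) * (x $ i + - z $ i)) + e"
  by (simp add: sq_def power2_norm_eq_inner inner_vec_def)

lemma Ck_on_sq: "open S \<Longrightarrow> Ck_on k (sq z e) S"
  unfolding sq_alt[abs_def]
  by (intro Ck_on_add Ck_on_sum Ck_on_mult Ck_on_component Ck_on_const)

lemma continuous_on_sq: "continuous_on S (sq z e)"
  unfolding sq_def by (intro continuous_intros)

lemma open_sq_vimage: "open T \<Longrightarrow> open {x. sq z e x \<in> T}"
  using open_vimage[OF _ continuous_on_sq, of T z e] by (simp add: vimage_def)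

lemma has_partial_sq: "has_partial i (sq z e) x (2 * (x $ i - z $ i))"
proof -
  have "sq z e (x + t *\<^sub>R axis i 1) = sq z e x + t * (2 * (x $ i - z $ i)) + t\<^sup>2" for t
  proof -
    have "(norm ((x - z) + t *\<^sub>R axis i 1))\<^sup>2 = (norm (x - z))\<^sup>2 + t * (2 * ((x - z) \<bullet> axis i 1)) + t\<^sup>2"
      unfolding power2_norm_eq_inner
      by (simp add: inner_simps inner_commute power2_eq_square inner_axis_axis algebra_simps)
    then show ?thesis by (simp add: sq_def inner_axis algebra_simps)
  qed
  then show ?thesis
    unfolding has_partial_def by (auto intro!: derivative_eq_intros)
qed

text \<open>Chain rule for s = |x - z|^2 + e: the gradient of s has squared length 4 (s - e), and
  its Laplacian is 2n.\<close>

lemma laplacian_radial: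
  fixes z :: "real^'n::finite"
  assumes T: "open T" and x: "sq z e x \<in> T"
    and dG: "\<And>t. t \<in> T \<Longrightarrow> (G has_real_derivative G' t) (at t)"
    and ddG: "\<And>t. t \<in> T \<Longrightarrow> (G' has_real_derivative G'' t) (at t)"
  shows "laplacian (\<lambda>x. G (sq z e x)) x
    = 4 * (sq z e x - e) * G'' (sq z e x) + 2 * real CARD('n) * G' (sq z e x)"
proof -
  define S where "S = {x. sq z e x \<in> T}"
  have S: "open S" "x \<in> S" unfolding S_def using open_sq_vimage[OF T] x by auto
  have 1: "partial_deriv i (\<lambda>x. G (sq z e x)) y = G' (sq z e y) * (2 * (y $ i - z $ i))" if "y \<in> S" for i y
    by (rule has_partial_partial_deriv[OF has_partial_compose[OF has_partial_sq]])
      (use that dG in \<open>auto simp: S_def\<close>)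
  have lin: "has_partial i (\<lambda>y. 2 * (y $ i - z $ i)) x 2" for i
    unfolding has_partial_def by (auto intro!: derivative_eq_intros)
  have 2: "partial_deriv i (partial_deriv i (\<lambda>x. G (sq z e x))) x
    = 4 * G'' (sq z e x) * ((x $ i + - z $ i) * (x $ i + - z $ i)) + 2 * G' (sq z e x)" for i
  proof -
    have "partial_deriv i (partial_deriv i (\<lambda>x. G (sq z e x))) x
      = partial_deriv i (\<lambda>y. G' (sq z e y) * (2 * (y $ i - z $ i))) x"
      by (rule partial_deriv_cong[OF S 1])
    also have "\<dots> = G'' (sq z e x) * (2 * (x $ i - z $ i)) * (2 * (x $ i - z $ i)) + 2 * G' (sq z e x)"
      by (rule has_partial_partial_deriv[OF has_partial_mult[OF has_partial_compose[OF has_partial_sq ddG[OF x]] lin]])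
    finally show ?thesis by (simp add: algebra_simps)
  qed
  have "sq z e x - e = (\<Sum>i\<in>UNIV. (x $ i + - z $ i) * (x $ i + - z $ i))"
    unfolding sq_alt by simp
  then show ?thesis
    unfolding laplacian_def 2 sum.distrib by (simp add: sum_distrib_left sum_distrib_right mult_ac)
qed

lemma Ck_on_sq_powr:
  assumes "open S" "\<And>x. x \<in> S \<Longrightarrow> 0 < sq z e x"
  shows "Ck_on k (\<lambda>x. sq z e x powr a) S"
  by (rule Ck_on_compose[where h = "\<lambda>t. t powr a", OF assms(1) Ck_on_sq[OF assms(1)] CkR_powr]) (use assms in auto)

lemma open_sq_pos: "open {x. 0 < sq z e x}"
  using open_sq_vimage[of "{0<..}"] by simp

text \<open>The factor s - e is split: the part s raises the lower power, and the part -e leaves the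
  correction term.\<close>

lemma laplacian_sq_powr:
  fixes z :: "real^'n::finite"
  assumes x: "0 < sq z e x"
  shows "laplacian (\<lambda>x. sq z e x powr a) x
    = 4 * a * (a - 1 + real CARD('n) / 2) * sq z e x powr (a - 1)
      + 4 * a * (a - 1) * (- e) * sq z e x powr (a - 2)"
proof -
  let ?s = "sq z e x"
  have "laplacian (\<lambda>x. sq z e x powr a) x
    = 4 * (?s - e) * (a * (a - 1) * ?s powr (a - 2)) + 2 * real CARD('n) * (a * ?s powr (a - 1))"
    by (rule laplacian_radial[where T = "{0<..}" and G' = "\<lambda>t. a * t powr (a - 1)"
          and G'' = "\<lambda>t. a * (a - 1) * t powr (a - 2)"])
      (use x in \<open>auto intro!: derivative_eq_intros\<close>)
  moreover have "?s powr (a - 1) = ?s * ?s powr (a - 2)"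
    using x powr_add[of ?s 1 "a - 2"] by simp
  ultimately show ?thesis by (simp add: algebra_simps)
qed

text \<open>Coefficients of \<open>\<Delta>\<^sup>m s\<^sup>a\<close> in dimension \<open>d\<close>. The last product vanishes for \<open>a = m - d/2\<close> unless \<open>l = m\<close>,
  which is what makes the bubble identity below exact.\<close>

definition lapc :: "real \<Rightarrow> real \<Rightarrow> nat \<Rightarrow> nat \<Rightarrow> real" where
  "lapc d a m l = 4 ^ m * real (m choose l) * (\<Prod>i<m + l. a - real i) * (\<Prod>i\<in>{l + 1..m}. a + d / 2 - real i)"

lemma choose_Suc_mult: "Suc l * (m choose Suc l) = (m - l) * (m choose l)"
  using binomial_absorption[of l m] binomial_absorb_comp[of m l] by metis

lemma lapc_0:
  "lapc d a (Suc m) 0 = lapc d a m 0 * (4 * (a - real m) * (a - real m - 1 + d / 2))"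
proof -
  define F P where "F = (\<Prod>i<m. a - real i)" and "P = (\<Prod>i\<in>{1..m}. a + d / 2 - real i)"
  have "lapc d a (Suc m) 0 = 4 ^ Suc m * (F * (a - real m)) * (P * (a + d / 2 - real (Suc m)))"
    by (simp add: lapc_def F_def P_def)
  moreover have "lapc d a m 0 = 4 ^ m * F * P"
    by (simp add: lapc_def F_def P_def)
  ultimately show ?thesis by (simp add: algebra_simps)
qed

text \<open>Recursion forced by one more Laplacian: in \<open>laplacian_sq_powr\<close> the first
  summand keeps the power of e and the second raises it by one, so index l+1 is fed from l+1 and
  from l.\<close>

lemma lapc_Suc:
  assumes "l \<le> m"
  shows "lapc d a (Suc m) (Suc l)
    = lapc d a m (Suc l) * (4 * (a - real m - real (Suc l)) * (a - real m - real (Suc l) - 1 + d / 2))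
      + lapc d a m l * (4 * (a - real m - real l) * (a - real m - real l - 1))"
proof (cases "l = m")
  case True
  define F where "F = (\<Prod>i<m + m. a - real i)"
  have "lapc d a (Suc m) (Suc m) = 4 ^ Suc m * (F * (a - 2 * real m) * (a - 2 * real m - 1))"
    by (simp add: lapc_def F_def algebra_simps)
  moreover have "lapc d a m (Suc m) = 0" "lapc d a m m = 4 ^ m * F"
    by (simp_all add: lapc_def F_def binomial_eq_0)
  ultimately show ?thesis unfolding True by (simp add: algebra_simps)
next
  case False
  then have lm: "l < m" using assms by simp
  define A P F where "A = a + d / 2" and "P = (\<Prod>i\<in>{l + 2..m}. A - real i)" and "F = (\<Prod>i<m + l + 2. a - real i)"
  have P1: "(\<Prod>i\<in>{l + 1..m}. A - real i) = (A - real (l + 1)) * P"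
    unfolding P_def using lm by (subst prod.atLeast_Suc_atMost) auto
  have P2: "(\<Prod>i\<in>{Suc l + 1..Suc m}. A - real i) = P * (A - real (Suc m))"
    unfolding P_def using lm by simp
  have F3: "(\<Prod>i<Suc m + Suc l. a - real i) = F"
    unfolding F_def by (simp add: mult_ac)
  have F1: "F = (\<Prod>i<m + l + 1. a - real i) * (a - real m - real (Suc l))"
    unfolding F_def by (simp add: algebra_simps)
  have F2: "F = (\<Prod>i<m + l. a - real i) * (a - real m - real l) * (a - real m - real l - 1)"
    unfolding F_def by (simp add: algebra_simps)
  have "real (Suc l) * real (m choose Suc l) = (real m - real l) * real (m choose l)"
    using choose_Suc_mult[of l m] lm by (metis of_nat_mult of_nat_diff assms)
  \<comment> \<open>Once common products are removed, the recursion is Pascal's rule up to a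
    discrepancy that the absorption identity above cancels.\<close>
  then have B: "real (Suc m choose Suc l) * (A - real (Suc m))
    = real (m choose Suc l) * (A - real m - real (Suc l) - 1) + real (m choose l) * (A - real (l + 1))"
    by (simp add: algebra_simps)
  have "lapc d a (Suc m) (Suc l) = 4 ^ Suc m * F * P * (real (Suc m choose Suc l) * (A - real (Suc m)))"
    unfolding lapc_def A_def[symmetric] P2 F3 by (simp only: mult_ac)
  also have "\<dots> = 4 ^ Suc m * F * P * real (m choose Suc l) * (A - real m - real (Suc l) - 1)
      + 4 ^ Suc m * F * P * (A - real (l + 1)) * real (m choose l)"
    unfolding B by (simp add: algebra_simps)
  also have "4 ^ Suc m * F * P * real (m choose Suc l) * (A - real m - real (Suc l) - 1)
    = lapc d a m (Suc l) * (4 * (a - real m - real (Suc l)) * (a - real m - real (Suc l) - 1 + d / 2))"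
  proof -
    have e: "A - real m - real (Suc l) - 1 = a - real m - real (Suc l) - 1 + d / 2"
      by (simp add: A_def)
    have "lapc d a m (Suc l) = 4 ^ m * real (m choose Suc l) * (\<Prod>i<m + l + 1. a - real i) * P"
      by (simp add: lapc_def P_def A_def)
    then show ?thesis by (simp only: e F1 power_Suc mult_ac)
  qed
  also have "4 ^ Suc m * F * P * (A - real (l + 1)) * real (m choose l)
    = lapc d a m l * (4 * (a - real m - real l) * (a - real m - real l - 1))"
    unfolding F2 lapc_def using P1 by (simp add: A_def)
  finally show ?thesis .
qed

lemma laplacian_funpow_sq_powr:
  fixes z :: "real^'n::finite"
  assumes x: "0 < sq z e x"
  shows "(laplacian ^^ m) (\<lambda>x. sq z e x powr a) x
    = (\<Sum>l\<le>m. lapc (real CARD('n)) a m l * ((- e) ^ l * sq z e x powr (a - real m - real l)))"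
  using x
proof (induction m arbitrary: x)
  case 0
  then show ?case by (simp add: lapc_def)
next
  case (Suc m)
  let ?s = "sq z e x" and ?d = "real CARD('n)"
  define X where "X l = (- e) ^ l * ?s powr (a - real (Suc m) - real l)" for l
  \<comment> \<open>A collects the coefficient that keeps the power of e, B the one that gains a
    factor -e.\<close>
  define A where "A l = lapc ?d a m l * (4 * (a - real m - real l) * (a - real m - real l - 1 + ?d / 2))" for l
  define B where "B l = lapc ?d a m l * (4 * (a - real m - real l) * (a - real m - real l - 1))" for l
  have "laplacian ((laplacian ^^ m) (\<lambda>x. sq z e x powr a)) x
    = laplacian (\<lambda>x. \<Sum>l\<le>m. (lapc ?d a m l * (- e) ^ l) * sq z e x powr (a - real m - real l)) x"
    by (rule laplacian_cong[OF open_sq_pos[of z e]]) (use Suc in \<open>auto simp: mult.assoc\<close>)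
  also have "\<dots> = (\<Sum>l\<le>m. (lapc ?d a m l * (- e) ^ l) * laplacian (\<lambda>x. sq z e x powr (a - real m - real l)) x)"
  proof -
    have "(laplacian ^^ 1) (\<lambda>x. \<Sum>l\<le>m. (lapc ?d a m l * (- e) ^ l) * sq z e x powr (a - real m - real l)) x
      = (\<Sum>l\<le>m. (lapc ?d a m l * (- e) ^ l) * (laplacian ^^ 1) (\<lambda>x. sq z e x powr (a - real m - real l)) x)"
      by (rule laplacian_funpow_sum[OF open_sq_pos[of z e]])
        (use Suc.prems in \<open>auto intro!: Ck_on_sq_powr open_sq_pos\<close>)
    then show ?thesis by simp
  qed
  also have "\<dots> = (\<Sum>l\<le>m. A l * X l + B l * X (Suc l))"
    by (intro sum.cong refl, subst laplacian_sq_powr[OF Suc.prems])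
      (simp add: A_def B_def X_def algebra_simps)
  also have "\<dots> = (\<Sum>l\<le>m. A l * X l) + (\<Sum>l\<le>m. B l * X (Suc l))"
    by (rule sum.distrib)
  \<comment> \<open>The new term is zero since \<open>m choose Suc m\<close> vanishes; it aligns
    this sum with the shifted one.\<close>
  also have "(\<Sum>l\<le>m. A l * X l) = (\<Sum>l\<le>Suc m. A l * X l)"
    by (simp add: A_def lapc_def binomial_eq_0)
  also have "\<dots> = A 0 * X 0 + (\<Sum>l\<le>m. A (Suc l) * X (Suc l))"
    by (rule sum.atMost_Suc_shift)
  also have "A 0 * X 0 + (\<Sum>l\<le>m. A (Suc l) * X (Suc l)) + (\<Sum>l\<le>m. B l * X (Suc l))
     = A 0 * X 0 + (\<Sum>l\<le>m. (A (Suc l) + B l) * X (Suc l))"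
    by (simp add: sum.distrib algebra_simps)
  also have "A 0 * X 0 = lapc ?d a (Suc m) 0 * X 0"
    by (simp add: A_def lapc_0)
  also have "(\<Sum>l\<le>m. (A (Suc l) + B l) * X (Suc l)) = (\<Sum>l\<le>m. lapc ?d a (Suc m) (Suc l) * X (Suc l))"
    by (intro sum.cong refl) (simp add: A_def B_def lapc_Suc del: of_nat_Suc)
  also have "lapc ?d a (Suc m) 0 * X 0 + \<dots> = (\<Sum>l\<le>Suc m. lapc ?d a (Suc m) l * X l)"
    by (rule sum.atMost_Suc_shift[symmetric])
  finally show ?case by (simp add: X_def)
qed

text \<open>Since e <= s, each factor e^l s^(-l) is at most one, so the constant does not depend on
  e.\<close>

lemma laplacian_funpow_sq_powr_bound:
  fixes z :: "real^'n::finite"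
  assumes x: "0 < sq z e x" and e: "0 \<le> e"
  shows "\<bar>(laplacian ^^ m) (\<lambda>x. sq z e x powr a) x\<bar>
    \<le> (\<Sum>l\<le>m. \<bar>lapc (real CARD('n)) a m l\<bar>) * sq z e x powr (a - real m)"
  unfolding laplacian_funpow_sq_powr[OF x] sum_distrib_right
proof (rule order_trans[OF sum_abs sum_mono])
  fix l
  let ?s = "sq z e x"
  have "e \<le> ?s" by (simp add: sq_def)
  then have "e ^ l \<le> ?s ^ l" using e by (rule power_mono)
  then have "e ^ l \<le> ?s powr real l" using x by (simp add: powr_realpow)
  then have "e ^ l * ?s powr (a - real m - real l) \<le> ?s powr real l * ?s powr (a - real m - real l)"
    by (rule mult_right_mono) simp
  also have "\<dots> = ?s powr (a - real m)" by (simp flip: powr_add)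
  finally show "\<bar>lapc (real CARD('n)) a m l * ((- e) ^ l * ?s powr (a - real m - real l))\<bar>
    \<le> \<bar>lapc (real CARD('n)) a m l\<bar> * ?s powr (a - real m)"
    using e by (simp add: abs_mult power_abs mult_left_mono)
qed

text \<open>Only the term l = m survives. Its coefficient is positive because it contains 2m
  negative factors a - i, and oddness of m turns (-e)^m into -e^m.\<close>

lemma laplacian_funpow_bubble:
  fixes z :: "real^'n::finite"
  assumes x: "0 < sq z e x" and "odd m" "2 * m < CARD('n)"
  defines "a \<equiv> real m - real CARD('n) / 2"
  defines "\<kappa> \<equiv> 4 ^ m * (\<Prod>i<2 * m. a - real i)"
  shows "0 < \<kappa>" "- (laplacian ^^ m) (\<lambda>x. sq z e x powr a) x = \<kappa> * (e ^ m * sq z e x powr (a - 2 * real m))"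
proof -
  let ?d = "real CARD('n)"
  have a: "a < 0" using assms(3) by (simp add: a_def)
  have "(\<Prod>i<2 * m. a - real i) = (\<Prod>i<2 * m. (-1) * (real i - a))"
    by (intro prod.cong) auto
  also have "\<dots> = (\<Prod>i<2 * m. real i - a)" by (subst prod.distrib) simp
  also have "\<dots> > 0" using a by (intro prod_pos) auto
  finally show "0 < \<kappa>" by (simp add: \<kappa>_def)
  have z: "lapc ?d a m l = 0" if "l < m" for l
  proof -
    have "(\<Prod>i\<in>{l + 1..m}. a + ?d / 2 - real i) = 0"
      using that by (intro prod_zero bexI[of _ m]) (auto simp: a_def)
    then show ?thesis by (simp add: lapc_def)
  qed
  have "(\<Sum>l\<le>m. lapc ?d a m l * ((- e) ^ l * sq z e x powr (a - real m - real l)))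
    = lapc ?d a m m * ((- e) ^ m * sq z e x powr (a - real m - real m))"
    by (subst sum.remove[of _ m]) (auto intro!: sum.neutral simp: z)
  moreover have "lapc ?d a m m = \<kappa>"
    unfolding lapc_def \<kappa>_def mult_2 by simp
  moreover have "a - real m - real m = a - 2 * real m" by simp
  moreover have "(- e) ^ m = - (e ^ m)" using \<open>odd m\<close> by (rule power_minus_odd)
  ultimately show "- (laplacian ^^ m) (\<lambda>x. sq z e x powr a) x = \<kappa> * (e ^ m * sq z e x powr (a - 2 * real m))"
    unfolding laplacian_funpow_sq_powr[OF x] by (simp only: mult_minus_left mult_minus_right minus_minus)
qed

section \<open>The cone of radial functions r^(-k) (1 - r/R)^j\<close>

definition radcone :: "real \<Rightarrow> real \<Rightarrow> nat \<Rightarrow> real^'n::finite \<Rightarrow> real" where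
  "radcone R k j x = sq 0 0 x powr (- k / 2) * (1 - sqrt (sq 0 0 x) / R) ^ j"

lemma Ck_on_radcone: "Ck_on i (radcone R k j) {x. 0 < sq 0 0 x}"
proof -
  have "Ck_on i (\<lambda>x. sq 0 0 x powr (- k / 2) * (\<lambda>t. t ^ j) (1 + (- 1 / R) * sq 0 0 x powr (1 / 2))) {x. 0 < sq 0 0 x}"
    by (intro Ck_on_mult Ck_on_compose[where h = "\<lambda>t. t ^ j", OF _ _ CkR_power] Ck_on_add
        Ck_on_const Ck_on_sq_powr open_sq_pos) auto
  then show ?thesis
    by (rule Ck_on_cong[OF open_sq_pos, rotated]) (simp add: radcone_def powr_half_sqrt)
qed

text \<open>For n >= 3 and k >= n - 2 all three coefficients are nonnegative, which makes the cone
  invariant. Truncated subtraction in \<open>j - 1\<close> and \<open>j - 2\<close> is harmless: the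
  coefficients vanish when it takes effect.\<close>

lemma laplacian_radcone:
  fixes x :: "real^'n::finite"
  assumes x: "0 < sq 0 0 x" and R: "R > 0"
  shows "laplacian (radcone R k j) x
    = k * (k + 2 - real CARD('n)) * radcone R (k + 2) j x
      + real j * (2 * k + 1 - real CARD('n)) / R * radcone R (k + 1) (j - 1) x
      + real j * (real j - 1) / R\<^sup>2 * radcone R k (j - 2) x"
proof -
  \<comment> \<open>The profile is a function of t = r^2. Its derivative is again a combination of
    such profiles, so the second derivative follows by using the same rule twice.\<close>
  define G where "G k j t = t powr (- k / 2) * (1 - sqrt t / R) ^ j" for k j and t :: real
  define G1 where "G1 k j t = - (k / 2) * G (k + 2) j t - real j / (2 * R) * G (k + 1) (j - 1) t" for k j t
  have alg: "- c / 2 * p1 * a + (i * b * (- (inverse s / 2 / R))) * p = - (c / 2) * (p1 * a) - i / (2 * R) * (p / s * b)"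
    for c p1 a i b s p :: real
    using R by (cases "s = 0") (simp_all add: field_simps)
  have dG: "(G k j has_real_derivative G1 k j t) (at t)" if "t \<in> {0<..}" for k j t
  proof -
    have p: "t powr (- (k + 2) / 2) = t powr (- k / 2 - 1)" by (rule arg_cong[of _ _ "(powr) t"]) (simp add: field_simps)
    have "- (k + 1) / 2 = - k / 2 - 1 / 2" by (simp add: field_simps)
    then have q: "t powr (- (k + 1) / 2) = t powr (- k / 2) / sqrt t"
      using that by (simp only: powr_diff powr_half_sqrt greaterThan_iff less_imp_le)
    have "((\<lambda>t. t powr (- k / 2) * (1 - sqrt t / R) ^ j) has_real_derivative
      (- k / 2 * t powr (- k / 2 - 1)) * (1 - sqrt t / R) ^ j
       + (real j * (1 - sqrt t / R) ^ (j - 1) * (- (inverse (sqrt t) / 2 / R))) * t powr (- k / 2)) (at t)"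
      using that R by (auto intro!: derivative_eq_intros)
    then show ?thesis
      unfolding G_def[abs_def] G1_def p q
      by (rule DERIV_cong) (rule alg)
  qed
  define G2 where "G2 k j t = - (k / 2) * G1 (k + 2) j t - real j / (2 * R) * G1 (k + 1) (j - 1) t" for k j t
  have dG1: "(G1 k j has_real_derivative G2 k j t) (at t)" if "t \<in> {0<..}" for k j t
    unfolding G1_def[abs_def] G2_def by (intro DERIV_diff DERIV_cmult dG[unfolded G1_def] that)
  let ?s = "sq 0 0 x"
  have tG: "?s * G k j ?s = G (k - 2) j ?s" for k j
    using x powr_add[of ?s 1 "- k / 2"] by (simp add: G_def diff_divide_distrib algebra_simps)
  have "laplacian (\<lambda>x. G k j (sq 0 0 x)) x
    = 4 * (?s - 0) * G2 k j ?s + 2 * real CARD('n) * G1 k j ?s"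
    by (rule laplacian_radial[where T = "{0<..}", OF _ _ dG dG1]) (use x in auto)
  also have "4 * (?s - 0) * G2 k j ?s = k * (k + 2) * (?s * G (k + 4) j ?s)
    + real j * (2 * k + 1) / R * (?s * G (k + 3) (j - 1) ?s)
    + real j * real (j - 1) / R\<^sup>2 * (?s * G (k + 2) (j - 1 - 1) ?s)"
    using R by (simp add: G2_def G1_def field_simps power2_eq_square)
  also have "\<dots> = k * (k + 2) * G (k + 2) j ?s
    + real j * (2 * k + 1) / R * G (k + 1) (j - 1) ?s
    + real j * (real j - 1) / R\<^sup>2 * G k (j - 2) ?s"
    unfolding tG by (cases j) (simp_all add: numeral_2_eq_2 add.commute)
  also have "2 * real CARD('n) * G1 k j ?s
    = - (real CARD('n) * k) * G (k + 2) j ?s - real j * real CARD('n) / R * G (k + 1) (j - 1) ?s"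
    using R by (simp add: G1_def field_simps)
  finally have "laplacian (\<lambda>x. G k j (sq 0 0 x)) x = k * (k + 2 - real CARD('n)) * G (k + 2) j ?s
      + real j * (2 * k + 1 - real CARD('n)) / R * G (k + 1) (j - 1) ?s
      + real j * (real j - 1) / R\<^sup>2 * G k (j - 2) ?s"
    by (simp add: algebra_simps add_divide_distrib diff_divide_distrib)
  then show ?thesis by (simp only: radcone_def[abs_def] G_def)
qed

text \<open>Of the three cone elements produced by each Laplacian, two are discarded as nonnegative.
  The kept one lowers j by two, with coefficient j (j - 1) / R^2 >= 1 / R^2.\<close>

lemma laplacian_funpow_radcone_ge:
  fixes x :: "real^'n::finite"
  assumes "0 < sq 0 0 x" "sqrt (sq 0 0 x) \<le> R" "R > 0" "CARD('n) \<ge> 3"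
    "real CARD('n) - 2 \<le> k" "2 * m \<le> j"
  shows "(laplacian ^^ m) (radcone R k j) x \<ge> radcone R k (j - 2 * m) x / R ^ (2 * m)"
  using assms(5,6)
proof (induction m arbitrary: k j)
  case (Suc m)
  let ?S = "{x :: real^'n. 0 < sq 0 0 x}" and ?n = "real CARD('n)"
  have nn: "radcone R k' j' x \<ge> 0" for k' j'
    using assms(2,3) by (simp add: radcone_def)
  have ge0: "(laplacian ^^ m) (radcone R k' j') x \<ge> 0" if "?n - 2 \<le> k'" "2 * m \<le> j'" for k' j'
    by (rule order_trans[OF _ Suc.IH[OF that]]) (use nn assms(3) in auto)
  define c1 c2 c3 where "c1 = k * (k + 2 - ?n)" and "c2 = real j * (2 * k + 1 - ?n) / R"
    and "c3 = real j * (real j - 1) / R\<^sup>2"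
  have k: "k \<ge> 1" "?n \<ge> 3" using Suc.prems assms(4) by linarith+
  have c: "c1 \<ge> 0" "c2 \<ge> 0" "c3 \<ge> 1 / R\<^sup>2"
  proof -
    show "c1 \<ge> 0" "c2 \<ge> 0" using k Suc.prems assms(3) by (auto simp: c1_def c2_def)
    have "1 * 1 \<le> real j * (real j - 1)" using Suc.prems by (intro mult_mono) auto
    then show "c3 \<ge> 1 / R\<^sup>2" using assms(3) by (simp add: c3_def divide_right_mono)
  qed
  let ?f = "\<lambda>x. c2 * radcone R (k + 1) (j - 1) x + c3 * radcone R k (j - 2) x"
  have Cf: "Ck_on (2 * m) ?f ?S"
    by (intro Ck_on_add Ck_on_mult Ck_on_const Ck_on_radcone open_sq_pos)
  have Cg: "Ck_on (2 * m) (\<lambda>x. c3 * radcone R k (j - 2) x) ?S"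
    by (intro Ck_on_mult Ck_on_const Ck_on_radcone open_sq_pos)
  \<comment> \<open>The innermost Laplacian is expanded, so that the induction hypothesis applies to
    cone functions with the changed exponents.\<close>
  have "(laplacian ^^ Suc m) (radcone R k j) x = (laplacian ^^ m) (laplacian (radcone R k j)) x"
    by (simp add: funpow_swap1)
  also have "\<dots> = (laplacian ^^ m) (\<lambda>x. c1 * radcone R (k + 2) j x + ?f x) x"
  proof (rule laplacian_funpow_cong[OF open_sq_pos[of 0 0]])
    fix y :: "real^'n" assume "y \<in> ?S"
    then show "laplacian (radcone R k j) y = c1 * radcone R (k + 2) j y + ?f y"
      using laplacian_radcone[of y R k j] assms(3) by (simp add: c1_def c2_def c3_def)
  qed (use assms in auto)
  also have "\<dots> = c1 * (laplacian ^^ m) (radcone R (k + 2) j) x + (laplacian ^^ m) ?f x"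
    by (rule laplacian_funpow_lincomb2[OF open_sq_pos Ck_on_radcone Cf]) (use assms in auto)
  also have "(laplacian ^^ m) ?f x = c2 * (laplacian ^^ m) (radcone R (k + 1) (j - 1)) x
     + (laplacian ^^ m) (\<lambda>x. c3 * radcone R k (j - 2) x) x"
    by (rule laplacian_funpow_lincomb2[OF open_sq_pos Ck_on_radcone Cg]) (use assms in auto)
  also have "(laplacian ^^ m) (\<lambda>x. c3 * radcone R k (j - 2) x) x = c3 * (laplacian ^^ m) (radcone R k (j - 2)) x"
    using laplacian_funpow_sum[OF open_sq_pos, of "{0}" m "\<lambda>_. radcone R k (j - 2)" 0 0 x "\<lambda>_. c3"]
      assms(1) Ck_on_radcone[of "2 * m" R k "j - 2", where 'a = 'n] by simp
  finally have "(laplacian ^^ Suc m) (radcone R k j) x = c1 * (laplacian ^^ m) (radcone R (k + 2) j) x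
     + (c2 * (laplacian ^^ m) (radcone R (k + 1) (j - 1)) x + c3 * (laplacian ^^ m) (radcone R k (j - 2)) x)" .
  moreover have "0 \<le> c1 * (laplacian ^^ m) (radcone R (k + 2) j) x"
    by (intro mult_nonneg_nonneg ge0 c) (use Suc.prems in auto)
  moreover have "0 \<le> c2 * (laplacian ^^ m) (radcone R (k + 1) (j - 1)) x"
    by (intro mult_nonneg_nonneg ge0 c) (use Suc.prems in auto)
  moreover have "radcone R k (j - 2 * Suc m) x / R ^ (2 * Suc m) \<le> c3 * (laplacian ^^ m) (radcone R k (j - 2)) x"
  proof -
    have "radcone R k (j - 2 * Suc m) x / R ^ (2 * Suc m) = 1 / R\<^sup>2 * (radcone R k (j - 2 - 2 * m) x / R ^ (2 * m))"
      by (simp add: power_add power2_eq_square)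
    also have "\<dots> \<le> c3 * (laplacian ^^ m) (radcone R k (j - 2)) x"
      by (intro mult_mono Suc.IH c) (use Suc.prems nn assms(3) order_trans[OF _ c(3)] in auto)
    finally show ?thesis .
  qed
  ultimately show ?case by linarith
qed auto

subsection \<open>The truncated bubble and the pointwise estimate\<close>

lemma integrable_indicator_mult:
  fixes f :: "'a::euclidean_space \<Rightarrow> real"
  assumes "compact K" "continuous_on K f"
  shows "integrable lborel (\<lambda>x. indicator K x * f x)"
  using borel_integrable_compact[OF assms] by simp

lemma integral_indicator_cball:
  fixes z :: "real^'n::finite"
  assumes "0 \<le> r"
  shows "integral\<^sup>L lborel (\<lambda>x. indicator (cball z r) x * c) = c * (unit_ball_vol (real CARD('n)) * r ^ CARD('n))"
  using content_cball[OF assms, of z] by (simp add: mult.commute)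

lemma sq_pos: "0 < e \<Longrightarrow> 0 < sq z e x"
  by (simp add: sq_def add_nonneg_pos)

lemma sq_le_iff_cball: "0 \<le> r \<Longrightarrow> sq z e x \<le> r\<^sup>2 + e \<longleftrightarrow> x \<in> cball z r"
  by (simp add: sq_def dist_norm norm_minus_commute abs_le_square_iff[symmetric])

lemma sq_ge_outside: "0 \<le> r \<Longrightarrow> 0 \<le> e \<Longrightarrow> x \<notin> cball z r \<Longrightarrow> r\<^sup>2 \<le> sq z e x"
  using sq_le_iff_cball[of r z e x] by linarith

text \<open>Halving the radius repeatedly replaces polar coordinates; \<open>e > 0\<close> makes the remainder tend to zero.\<close>

lemma integral_sq_powr_cball_le:
  assumes m: "1 \<le> m" "2 * m < CARD('n)"
  shows "\<exists>D>0. \<forall>(z :: real^'n::finite) e r. 0 < e \<longrightarrow> 0 < r \<longrightarrow>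
    integral\<^sup>L lborel (\<lambda>x. indicator (cball z r) x * sq z e x powr (real m - real CARD('n) / 2)) \<le> D * r ^ (2 * m)"
proof -
  let ?n = "CARD('n)"
  define p where "p = real m - real ?n / 2"
  define V where "V = unit_ball_vol (real ?n)"
  \<comment> \<open>On the shell between r/2 and r the integrand is at most (r/2)^(2m-n); times the
    volume V r^n of the full ball this is E r^(2m).\<close>
  define E where "E = 2 ^ (?n - 2 * m) * V"
  have V: "V > 0" by (simp add: V_def)
  then have E: "E > 0" by (simp add: E_def)
  have p: "p < 0" using m by (simp add: p_def)
  have "integral\<^sup>L lborel (\<lambda>x. indicator (cball z r) x * sq z e x powr p) \<le> (2 * E) * r ^ (2 * m)"
    if e: "0 < e" and r: "0 < r" for z :: "real^'n" and e r
  proof -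
    define J where "J r = integral\<^sup>L lborel (\<lambda>x. indicator (cball z r) x * sq z e x powr p)" for r
    have cont: "continuous_on A (\<lambda>x. sq z e x powr p)" for A
    proof -
      have "sq z e x \<noteq> 0" for x using sq_pos[OF e, of z x] by simp
      then show ?thesis by (intro continuous_intros continuous_on_sq) auto
    qed
    have int: "integrable lborel (\<lambda>x. indicator (cball z r) x * sq z e x powr p)" for r
      by (intro integrable_indicator_mult cont) auto
    have intc: "integrable lborel (\<lambda>x. indicator (cball z r) x * c)" for r c :: real
      by (intro integrable_indicator_mult continuous_intros) auto
    have half: "J r \<le> J (r / 2) + E * r ^ (2 * m)" if r: "0 < r" for r
    proof -
      have "J r \<le> integral\<^sup>L lborel (\<lambda>x. indicator (cball z (r / 2)) x * sq z e x powr p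
          + indicator (cball z r) x * ((r / 2)\<^sup>2) powr p)"
        unfolding J_def
      proof (intro integral_mono Bochner_Integration.integrable_add int intc)
        fix x
        show "indicator (cball z r) x * sq z e x powr p
          \<le> indicator (cball z (r / 2)) x * sq z e x powr p + indicator (cball z r) x * ((r / 2)\<^sup>2) powr p"
        proof (cases "x \<in> cball z (r / 2)")
          case True
          then show ?thesis by (auto simp: indicator_def)
        next
          case False
          have "sq z e x powr p \<le> ((r / 2)\<^sup>2) powr p"
            using sq_ge_outside[of "r / 2" e x z] False r e p
            by (intro powr_mono2') auto
          then show ?thesis using False by (auto simp: indicator_def)
        qed
      qed
      also have "\<dots> = J (r / 2) + ((r / 2)\<^sup>2) powr p * (V * r ^ ?n)"
        unfolding J_def V_def using r int intc integral_indicator_cball[of r z]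
        by (subst Bochner_Integration.integral_add) auto
      also have "((r / 2)\<^sup>2) powr p * (V * r ^ ?n) = E * r ^ (2 * m)"
      proof -
        define h where "h = r / 2"
        have h: "h > 0" "r = 2 * h" using r by (auto simp: h_def)
        have "(h\<^sup>2) powr p * h ^ ?n = h powr (2 * p) * h powr real ?n"
          using h by (simp add: powr_powr powr_realpow flip: powr_numeral)
        also have "\<dots> = h powr real (2 * m)"
          unfolding powr_add[symmetric] p_def by (simp add: algebra_simps)
        finally have "(h\<^sup>2) powr p * h ^ ?n = h ^ (2 * m)" using h by (simp only: powr_realpow)
        moreover have "(2::real) ^ ?n = 2 ^ (?n - 2 * m) * 2 ^ (2 * m)"
          using m by (simp flip: power_add)
        ultimately show ?thesis
          unfolding h_def[symmetric] unfolding h(2) E_def power_mult_distrib by simp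
      qed
      finally show ?thesis .
    qed
    \<comment> \<open>Since m >= 1, each halving divides r^(2m) by at least four, so the geometric
      series stays below twice its first term.\<close>
    have iter: "J r \<le> 2 * E * r ^ (2 * m) + J (r / 2 ^ k)" if "0 < r" for r k
      using that
    proof (induction k arbitrary: r)
      case 0
      then show ?case using E by simp
    next
      case (Suc k)
      have "2 ^ (2 * 1) \<le> (2::real) ^ (2 * m)" using m by (intro power_increasing) auto
      then have "(r / 2) ^ (2 * m) \<le> r ^ (2 * m) / 4"
        unfolding power_divide using Suc.prems by (intro frac_le) auto
      then have "2 * E * (r / 2) ^ (2 * m) \<le> 2 * E * (r ^ (2 * m) / 4)"
        using E by (intro mult_left_mono) auto
      moreover have "0 \<le> E * r ^ (2 * m)" using E by simp
      ultimately show ?case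
        using half[OF Suc.prems] Suc.IH[of "r / 2"] Suc.prems by (simp add: divide_divide_eq_left)
    qed
    \<comment> \<open>Crude bound from s >= e. It is useful because e stays fixed while the radius
      r/2^k tends to zero.\<close>
    have small: "J r \<le> e powr p * (V * r ^ ?n)" if "0 < r" for r
    proof -
      have "J r \<le> integral\<^sup>L lborel (\<lambda>x. indicator (cball z r) x * e powr p)"
        unfolding J_def
      proof (intro integral_mono int intc mult_left_mono)
        show "sq z e x powr p \<le> e powr p" for x
          using e p by (intro powr_mono2') (auto simp: sq_def)
      qed auto
      then show ?thesis using that by (simp only: integral_indicator_cball V_def)
    qed
    have "J r \<le> 2 * E * r ^ (2 * m) + e powr p * (V * (r / 2 ^ k) ^ ?n)" for k
      using iter[OF r, of k] small[of "r / 2 ^ k"] r by simp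
    moreover have "(\<lambda>k. 2 * E * r ^ (2 * m) + e powr p * (V * (r / 2 ^ k) ^ ?n))
        \<longlonglongrightarrow> 2 * E * r ^ (2 * m) + e powr p * (V * 0 ^ ?n)"
    proof (intro tendsto_intros)
      have "(\<lambda>k. r * (1 / 2) ^ k) \<longlonglongrightarrow> r * 0"
        by (intro tendsto_intros LIMSEQ_power_zero) auto
      then show "(\<lambda>k. r / 2 ^ k) \<longlonglongrightarrow> 0" by (simp add: power_divide)
    qed
    ultimately have "J r \<le> 2 * E * r ^ (2 * m) + e powr p * (V * 0 ^ ?n)"
      by (intro LIMSEQ_le_const) auto
    then show ?thesis by (simp add: J_def power_0_left)
  qed
  then show ?thesis using E unfolding p_def by (intro exI[of _ "2 * E"]) auto
qed

text \<open>The exponent \<open>n\<close> inside the truncation is chosen so large that all terms of the binomial expansion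
  except the leading one have \<open>\<Delta>\<^sup>m\<close> bounded by a multiple of \<open>\<rho>\<^sup>-\<^sup>n\<close>, uniformly in \<open>e\<close>.\<close>

definition bubble :: "nat \<Rightarrow> real^'n::finite \<Rightarrow> real \<Rightarrow> real \<Rightarrow> real^'n \<Rightarrow> real" where
  "bubble m z \<rho> e x = sq z e x powr (real m - real CARD('n) / 2)
     * max 0 (1 - (sq z e x / \<rho>\<^sup>2) ^ CARD('n)) ^ (2 * m + 1)"

section \<open>Size, support and regularity of the truncated bubble\<close>

lemma bubble_nonneg: "0 \<le> bubble m z \<rho> e x"
  by (simp add: bubble_def)

lemma bubble_le:
  assumes "0 \<le> e"
  shows "bubble m (z :: real^'n::finite) \<rho> e x \<le> sq z e x powr (real m - real CARD('n) / 2)"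
proof -
  have "0 \<le> (sq z e x / \<rho>\<^sup>2) ^ CARD('n)" using assms by (simp add: sq_def)
  then have "max 0 (1 - (sq z e x / \<rho>\<^sup>2) ^ CARD('n)) ^ (2 * m + 1) \<le> 1 ^ (2 * m + 1)"
    by (intro power_mono) auto
  then show ?thesis unfolding bubble_def by (simp add: mult_left_le)
qed

lemma bubble_eq_0:
  assumes "\<rho>\<^sup>2 \<le> sq z e x" "0 < \<rho>"
  shows "bubble m z \<rho> e x = 0"
proof -
  have "1 \<le> (sq z e x / \<rho>\<^sup>2) ^ CARD('a)" using assms by (intro one_le_power) simp
  then show ?thesis by (simp add: bubble_def max_absorb1)
qed

lemma Ck_on_bubble:
  assumes "0 < e" shows "Ck_on (2 * m) (bubble m z \<rho> e) UNIV"
proof -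
  have "Ck_on (2 * m) (\<lambda>x. sq z e x powr (real m - real CARD('a) / 2)
     * (\<lambda>t. max 0 t ^ (2 * m + 1)) (1 + (- ((1 / \<rho>\<^sup>2) ^ CARD('a))) * (\<lambda>t. t ^ CARD('a)) (sq z e x))) UNIV"
    by (intro Ck_on_mult Ck_on_compose[where h = "\<lambda>t. max 0 t ^ (2 * m + 1)", OF _ _ CkR_pos_part_power]
        Ck_on_compose[where h = "\<lambda>t. t ^ CARD('a)", OF _ _ CkR_power] Ck_on_add
        Ck_on_const Ck_on_sq_powr Ck_on_sq) (use assms sq_pos in auto)
  then show ?thesis
    by (rule Ck_on_cong[rotated 2]) (auto simp: bubble_def power_divide)
qed

text \<open>Where s < \<rho>^2 the positive part is inactive, and the binomial theorem leaves pure
  powers of s, whose iterated Laplacians are known.\<close>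

lemma bubble_expand:
  assumes "0 < e" "sq z e x < \<rho>\<^sup>2" "0 < \<rho>"
  shows "bubble m (z :: real^'n::finite) \<rho> e x = (\<Sum>j\<le>2 * m + 1. (real (2 * m + 1 choose j) * (- ((1 / \<rho>\<^sup>2) ^ CARD('n))) ^ j)
      * sq z e x powr (real m - real CARD('n) / 2 + real (CARD('n) * j)))"
proof -
  let ?s = "sq z e x" and ?p = "real m - real CARD('n) / 2"
  have s: "0 < ?s" using assms sq_pos by blast
  have "(?s / \<rho>\<^sup>2) ^ CARD('n) \<le> 1" using assms s by (intro power_le_one) auto
  define q where "q = - ((1 / \<rho>\<^sup>2) ^ CARD('n))"
  define N where "N = 2 * m + 1"
  have "bubble m z \<rho> e x = ?s powr ?p * (q * ?s ^ CARD('n) + 1) ^ N"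
    using \<open>(?s / \<rho>\<^sup>2) ^ CARD('n) \<le> 1\<close> by (simp add: bubble_def power_divide q_def N_def)
  also have "\<dots> = ?s powr ?p * (\<Sum>j\<le>N. real (N choose j) * (q * ?s ^ CARD('n)) ^ j * 1 ^ (N - j))"
    by (subst binomial_ring) simp
  also have "\<dots> = (\<Sum>j\<le>N. (real (N choose j) * q ^ j) * (?s powr ?p * ?s ^ (CARD('n) * j)))"
    unfolding sum_distrib_left
    by (intro sum.cong refl) (simp add: power_mult_distrib power_mult)
  also have "\<dots> = (\<Sum>j\<le>N. (real (N choose j) * q ^ j) * ?s powr (?p + real (CARD('n) * j)))"
    unfolding powr_add powr_realpow[OF s] ..
  finally show ?thesis unfolding q_def N_def .
qed

text \<open>Outside the closed ball this is locality; continuity of \<Delta>^m f extends it to the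
  boundary sphere.\<close>

lemma laplacian_funpow_zero_off_ball:
  fixes f :: "real^'n::finite \<Rightarrow> real"
  assumes f: "Ck_on (2 * m) f UNIV" "\<And>x. x \<notin> cball z r \<Longrightarrow> f x = 0" and x: "x \<notin> ball z r"
  shows "(laplacian ^^ m) f x = 0"
proof -
  have c: "continuous_on UNIV ((laplacian ^^ m) f)"
    using Ck_on_laplacian_funpow[of UNIV 0 m f] f(1) by (simp add: Ck_on_0)
  have "closure (- cball z r) \<subseteq> {x. (laplacian ^^ m) f x = 0}"
    by (intro closure_minimal closed_Collect_eq c continuous_on_const subsetI CollectI
        laplacian_funpow_zero_off[OF closed_cball f(2)]) auto
  moreover have "x \<in> closure (- cball z r)" using x by (simp add: closure_complement)
  ultimately show ?thesis by blast
qed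

lemma laplacian_funpow_bubble_eq_0:
  assumes e: "0 < e" "e < \<rho>\<^sup>2" "0 < \<rho>" and x: "\<rho>\<^sup>2 \<le> sq z e x"
  shows "(laplacian ^^ m) (bubble m z \<rho> e) x = 0"
proof -
  \<comment> \<open>\<open>cball z r\<close> is exactly the set where s <= \<rho>^2.\<close>
  define r where "r = sqrt (\<rho>\<^sup>2 - e)"
  have r: "r\<^sup>2 = \<rho>\<^sup>2 - e" "0 \<le> r" using e by (simp_all add: r_def)
  show ?thesis
  proof (rule laplacian_funpow_zero_off_ball[OF Ck_on_bubble[OF e(1)]])
    fix y assume "y \<notin> cball z r"
    then show "bubble m z \<rho> e y = 0"
      using sq_le_iff_cball[OF r(2), of z e y] r(1) by (intro bubble_eq_0 e(3)) auto
  next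
    have "r\<^sup>2 \<le> (dist z x)\<^sup>2" using x r(1) by (simp add: sq_def dist_norm norm_minus_commute)
    then show "x \<notin> ball z r" using power2_le_imp_le[of r "dist z x"] by simp
  qed
qed

text \<open>The term j = 0 of the expansion gives the exact bubble identity. For j >= 1 the power
  s^(nj - n/2) has a nonnegative exponent, hence is at most \<rho>^(2nj - n), and the coefficient
  contributes \<rho>^(-2nj).\<close>

lemma laplacian_funpow_bubble_ge:
  assumes m: "odd m" "2 * m < CARD('n)"
  shows "\<exists>\<kappa>>0. \<exists>B>0. \<forall>(z :: real^'n::finite) \<rho> e x. 0 < \<rho> \<longrightarrow> 0 < e \<longrightarrow> e < \<rho>\<^sup>2 \<longrightarrow>
    - (B / \<rho> ^ CARD('n)) \<le> - (laplacian ^^ m) (bubble m z \<rho> e) x \<and>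
    (sq z e x < \<rho>\<^sup>2 \<longrightarrow> \<kappa> * (e ^ m * sq z e x powr (- real m - real CARD('n) / 2)) - B / \<rho> ^ CARD('n)
      \<le> - (laplacian ^^ m) (bubble m z \<rho> e) x)"
proof -
  let ?n = "CARD('n)"
  define p where "p = real m - real ?n / 2"
  define \<kappa> where "\<kappa> = 4 ^ m * (\<Prod>i<2 * m. p - real i)"
  define b where "b j = (\<Sum>l\<le>m. \<bar>lapc (real ?n) (p + real (?n * j)) m l\<bar>)" for j
  \<comment> \<open>The summand 1 ensures positivity; the rest adds up the terms with j >=
    1.\<close>
  define B where "B = 1 + (\<Sum>j = 1..2 * m + 1. real (2 * m + 1 choose j) * b j)"
  have b0: "b j \<ge> 0" for j by (simp add: b_def sum_nonneg)
  have \<kappa>: "\<kappa> > 0"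
    using laplacian_funpow_bubble(1)[of 0 1 0 m] m by (simp add: \<kappa>_def p_def sq_pos)
  have B: "B > 0" unfolding B_def by (intro add_pos_nonneg sum_nonneg mult_nonneg_nonneg b0) auto
  have main: "\<kappa> * (e ^ m * sq z e x powr (- real m - real ?n / 2)) - B / \<rho> ^ ?n
      \<le> - (laplacian ^^ m) (bubble m z \<rho> e) x"
    if h: "0 < \<rho>" "0 < e" "sq z e x < \<rho>\<^sup>2" for z :: "real^'n" and \<rho> e x
  proof -
    let ?s = "sq z e x"
    define c where "c j = real (2 * m + 1 choose j) * (- ((1 / \<rho>\<^sup>2) ^ ?n)) ^ j" for j
    define U where "U = {x. sq z e x < \<rho>\<^sup>2}"
    have U: "open U" unfolding U_def by (intro open_Collect_less continuous_on_sq continuous_on_const)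
    have s: "0 < ?s" using h sq_pos by blast
    have pos: "\<And>y. 0 < sq z e y" using h sq_pos by blast
    have "(laplacian ^^ m) (bubble m z \<rho> e) x
      = (laplacian ^^ m) (\<lambda>x. \<Sum>j\<le>2 * m + 1. c j * sq z e x powr (p + real (?n * j))) x"
      by (rule laplacian_funpow_cong[OF U])
        (use h bubble_expand[OF h(2) _ h(1)] in \<open>auto simp: U_def c_def p_def\<close>)
    also have "\<dots> = (\<Sum>j\<le>2 * m + 1. c j * (laplacian ^^ m) (\<lambda>x. sq z e x powr (p + real (?n * j))) x)"
      by (rule laplacian_funpow_sum[of UNIV]) (use pos in \<open>auto intro!: Ck_on_sq_powr\<close>)
    also have "\<dots> = (laplacian ^^ m) (\<lambda>x. sq z e x powr p) x
      + (\<Sum>j = 1..2 * m + 1. c j * (laplacian ^^ m) (\<lambda>x. sq z e x powr (p + real (?n * j))) x)"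
      by (simp only: atMost_atLeast0, subst sum.atLeast_Suc_atMost) (simp_all add: c_def)
    finally have eq: "- (laplacian ^^ m) (bubble m z \<rho> e) x = \<kappa> * (e ^ m * ?s powr (p - 2 * real m))
      - (\<Sum>j = 1..2 * m + 1. c j * (laplacian ^^ m) (\<lambda>x. sq z e x powr (p + real (?n * j))) x)"
      using laplacian_funpow_bubble(2)[OF s m] by (simp add: \<kappa>_def p_def)
    have t: "c j * (laplacian ^^ m) (\<lambda>x. sq z e x powr (p + real (?n * j))) x
      \<le> (real (2 * m + 1 choose j) * b j) / \<rho> ^ ?n" if j: "1 \<le> j" for j
    proof -
      have ex: "p + real (?n * j) - real m = real (?n * j) - real ?n / 2" by (simp add: p_def)
      have ex0: "0 \<le> real (?n * j) - real ?n / 2"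
      proof -
        have "real ?n * 1 \<le> real ?n * real j" using j by (intro mult_left_mono) auto
        then show ?thesis by simp
      qed
      have "\<bar>(laplacian ^^ m) (\<lambda>x. sq z e x powr (p + real (?n * j))) x\<bar>
        \<le> b j * ?s powr (real (?n * j) - real ?n / 2)"
        using laplacian_funpow_sq_powr_bound[OF s less_imp_le[OF h(2)], of m "p + real (?n * j)"]
        unfolding ex b_def .
      also have "\<dots> \<le> b j * (\<rho>\<^sup>2) powr (real (?n * j) - real ?n / 2)"
        using h s ex0 by (intro mult_left_mono b0 powr_mono2) auto
      also have "(\<rho>\<^sup>2) powr (real (?n * j) - real ?n / 2) = (\<rho>\<^sup>2) ^ (?n * j) / \<rho> ^ ?n"
      proof -
        have "(\<rho>\<^sup>2) powr (real ?n / 2) = \<rho> powr real ?n"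
          using h(1) by (simp add: powr_powr flip: powr_numeral)
        then show ?thesis
          using h(1) by (simp only: powr_diff powr_realpow zero_less_power)
      qed
      finally have l: "\<bar>(laplacian ^^ m) (\<lambda>x. sq z e x powr (p + real (?n * j))) x\<bar>
        \<le> b j * ((\<rho>\<^sup>2) ^ (?n * j) / \<rho> ^ ?n)" .
      have "c j * (laplacian ^^ m) (\<lambda>x. sq z e x powr (p + real (?n * j))) x
        \<le> \<bar>c j\<bar> * \<bar>(laplacian ^^ m) (\<lambda>x. sq z e x powr (p + real (?n * j))) x\<bar>"
        by (metis abs_ge_self abs_mult)
      also have "\<dots> \<le> \<bar>c j\<bar> * (b j * ((\<rho>\<^sup>2) ^ (?n * j) / \<rho> ^ ?n))"
        by (intro mult_left_mono l) auto
      also have "\<bar>c j\<bar> = real (2 * m + 1 choose j) / (\<rho>\<^sup>2) ^ (?n * j)"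
      proof -
        define q where "q = (1 / \<rho>\<^sup>2) ^ ?n"
        have "0 \<le> q" by (simp add: q_def)
        moreover have "q ^ j = 1 / (\<rho>\<^sup>2) ^ (?n * j)" by (simp add: q_def power_divide power_mult)
        ultimately show ?thesis unfolding c_def q_def[symmetric] by (simp add: abs_mult power_abs)
      qed
      finally show ?thesis using h(1) by simp
    qed
    have "(\<Sum>j = 1..2 * m + 1. c j * (laplacian ^^ m) (\<lambda>x. sq z e x powr (p + real (?n * j))) x)
      \<le> (\<Sum>j = 1..2 * m + 1. (real (2 * m + 1 choose j) * b j) / \<rho> ^ ?n)"
      by (intro sum_mono t) auto
    also have "\<dots> \<le> B / \<rho> ^ ?n"
      unfolding sum_divide_distrib[symmetric] B_def using h(1) by (intro divide_right_mono) auto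
    finally show ?thesis
      unfolding eq by (simp add: p_def algebra_simps)
  qed
  have "- (B / \<rho> ^ ?n) \<le> - (laplacian ^^ m) (bubble m z \<rho> e) x"
    if h: "0 < \<rho>" "0 < e" "e < \<rho>\<^sup>2" for z :: "real^'n" and \<rho> e x
  proof (cases "sq z e x < \<rho>\<^sup>2")
    case True
    have "0 \<le> \<kappa> * (e ^ m * sq z e x powr (- real m - real ?n / 2))"
      using \<kappa> h by simp
    then show ?thesis using main[OF h(1,2) True] by linarith
  next
    case False
    then show ?thesis using laplacian_funpow_bubble_eq_0[OF h(2,3,1), of z x m] B h by simp
  qed
  with main \<kappa> B show ?thesis by blast
qed

text \<open>Green's formula tested with the bubble at z. The concentrated part of its \<Delta>^m
  sees v z, the remainder costs the mean of v, and the bubble integrated against f is split at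
  radius r. The constant precedes all other quantifiers, and r remains free for later
  balancing.\<close>

lemma pointwise_estimate:
  assumes m: "odd m" "2 * m < CARD('n)"
  shows "\<exists>C>0. \<forall>S v (z :: real^'n::finite) \<rho> L I r.
    open S \<longrightarrow> cball z \<rho> \<subseteq> S \<longrightarrow> 0 < \<rho> \<longrightarrow> 0 < r \<longrightarrow> Ck_on (2 * m) v S \<longrightarrow>
    (\<forall>x\<in>cball z \<rho>. 0 \<le> v x \<and> 0 \<le> - (laplacian ^^ m) v x \<and> - (laplacian ^^ m) v x \<le> L) \<longrightarrow>
    integral\<^sup>L lborel (\<lambda>x. indicator (cball z \<rho>) x * (- (laplacian ^^ m) v x)) \<le> I \<longrightarrow>
    v z \<le> C * (integral\<^sup>L lborel (\<lambda>x. indicator (cball z \<rho>) x * v x) / \<rho> ^ CARD('n)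
       + L * r ^ (2 * m) + (r\<^sup>2) powr (real m - real CARD('n) / 2) * I)"
proof -
  let ?n = "CARD('n)"
  define p where "p = real m - real ?n / 2"
  have p: "p < 0" using m by (simp add: p_def)
  obtain \<kappa> B where \<kappa>: "\<kappa> > 0" and B: "B > 0" and bub': "\<forall>(z :: real^'n) \<rho> e x. 0 < \<rho> \<longrightarrow> 0 < e \<longrightarrow> e < \<rho>\<^sup>2 \<longrightarrow>
    - (B / \<rho> ^ ?n) \<le> - (laplacian ^^ m) (bubble m z \<rho> e) x \<and>
    (sq z e x < \<rho>\<^sup>2 \<longrightarrow> \<kappa> * (e ^ m * sq z e x powr (- real m - real ?n / 2)) - B / \<rho> ^ ?n
      \<le> - (laplacian ^^ m) (bubble m z \<rho> e) x)"
    using laplacian_funpow_bubble_ge[OF m] by (elim exE conjE) (rule that)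
  note bub = bub'[rule_format]
  have "1 \<le> m" using m(1) by (cases m) auto
  from integral_sq_powr_cball_le[OF this m(2), folded p_def]
  obtain D where D0: "D > 0" and D': "\<forall>(z :: real^'n) e r. 0 < e \<longrightarrow> 0 < r \<longrightarrow>
    integral\<^sup>L lborel (\<lambda>x. indicator (cball z r) x * sq z e x powr p) \<le> D * r ^ (2 * m)"
    by (elim exE conjE) (rule that)
  note D = D0 D'[rule_format]
  define V where "V = unit_ball_vol (real ?n)"
  \<comment> \<open>Mass near z: on \<open>cball z \<epsilon>\<close>, of volume V \<epsilon>^n, one
    has s <= 2e, and the final 1/2 comes from v being at least half of v z there.\<close>
  define c where "c = \<kappa> * 2 powr (- real m - real ?n / 2) * V / 2"
  have V: "V > 0" by (simp add: V_def)
  have c: "c > 0" using \<kappa> V by (simp add: c_def)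
  define C where "C = (B + D + 1) / c"
  have C: "C > 0" using B D c by (simp add: C_def)
  have "v z \<le> C * (integral\<^sup>L lborel (\<lambda>x. indicator (cball z \<rho>) x * v x) / \<rho> ^ ?n
       + L * r ^ (2 * m) + (r\<^sup>2) powr p * I)"
    if S: "open S" "cball z \<rho> \<subseteq> S" and \<rho>: "0 < \<rho>" and r: "0 < r" and v: "Ck_on (2 * m) v S"
      and h: "\<forall>x\<in>cball z \<rho>. 0 \<le> v x \<and> 0 \<le> - (laplacian ^^ m) v x \<and> - (laplacian ^^ m) v x \<le> L"
      and I: "integral\<^sup>L lborel (\<lambda>x. indicator (cball z \<rho>) x * (- (laplacian ^^ m) v x)) \<le> I"
    for S v and z :: "real^'n" and \<rho> L I r
  proof -
    define f where "f x = - (laplacian ^^ m) v x" for x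
    let ?K = "cball z \<rho>"
    define A where "A = integral\<^sup>L lborel (\<lambda>x. indicator ?K x * v x)"
    define Q where "Q = A / \<rho> ^ ?n + L * r ^ (2 * m) + (r\<^sup>2) powr p * I"
    have z: "z \<in> ?K" using \<rho> by simp
    have L: "0 \<le> L" using bspec[OF h z] by linarith
    have cv: "continuous_on ?K v" using v S(2) Ck_on_imp_continuous continuous_on_subset by blast
    have "continuous_on S ((laplacian ^^ m) v)"
      using Ck_on_laplacian_funpow[OF S(1), of 0 m v] v by (simp add: Ck_on_0)
    then have cf: "continuous_on ?K f"
      unfolding f_def using S(2) by (intro continuous_intros) (rule continuous_on_subset)
    have intv: "integrable lborel (\<lambda>x. indicator ?K x * v x)"
      and intf: "integrable lborel (\<lambda>x. indicator ?K x * f x)"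
      by (intro integrable_indicator_mult cv cf compact_cball)+
    have A0: "0 \<le> A" unfolding A_def
      by (rule Bochner_Integration.integral_nonneg) (use h in \<open>auto simp: indicator_def\<close>)
    have I0: "0 \<le> I"
    proof -
      have "0 \<le> integral\<^sup>L lborel (\<lambda>x. indicator ?K x * f x)"
        by (rule Bochner_Integration.integral_nonneg) (use h in \<open>auto simp: indicator_def f_def\<close>)
      then show ?thesis using I by (simp add: f_def)
    qed
    have Qi: "0 \<le> A / \<rho> ^ ?n" "0 \<le> L * r ^ (2 * m)" "0 \<le> (r\<^sup>2) powr p * I"
      using A0 \<rho> L r I0 by auto
    show "v z \<le> C * (A / \<rho> ^ ?n + L * r ^ (2 * m) + (r\<^sup>2) powr p * I)"
    \<comment> \<open>If v z <= 0, the right-hand side is nonnegative and the claim is immediate.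
      Otherwise continuity yields a ball on which v is at least half of v z.\<close>
    proof (cases "v z \<le> 0")
      case True
      have "0 \<le> C * (A / \<rho> ^ ?n + L * r ^ (2 * m) + (r\<^sup>2) powr p * I)"
        by (rule mult_nonneg_nonneg[OF less_imp_le[OF C] add_nonneg_nonneg[OF add_nonneg_nonneg[OF Qi(1,2)] Qi(3)]])
      then show ?thesis using True by linarith
    next
      case False
      then have vz: "v z > 0" by simp
      obtain d where d: "d > 0" "\<And>x. x \<in> ?K \<Longrightarrow> dist x z < d \<Longrightarrow> dist (v x) (v z) < v z / 2"
        using cv z vz unfolding continuous_on_iff by (metis half_gt_zero)
      define \<epsilon> where "\<epsilon> = min (\<rho> / 2) (d / 2)"
      have \<epsilon>: "0 < \<epsilon>" "\<epsilon> < d" "\<epsilon> \<le> \<rho> / 2" using d(1) \<rho> by (auto simp: \<epsilon>_def min_def)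
      \<comment> \<open>One sufficiently small e replaces the limit, because \<kappa>, B and D do
        not depend on it.\<close>
      define e where "e = \<epsilon>\<^sup>2"
      have e: "0 < e" using \<epsilon> by (simp add: e_def)
      have "e \<le> (\<rho> / 2)\<^sup>2" unfolding e_def using \<epsilon> by (intro power_mono) auto
      then have e2: "2 * e < \<rho>\<^sup>2" using \<rho> by (simp add: power_divide) (smt (verit) zero_less_power)
      let ?\<phi> = "bubble m z \<rho> e"
      have sub: "cball z \<epsilon> \<subseteq> ?K" using \<epsilon> \<rho> by (intro subset_cball) auto
      have vhalf: "v z / 2 \<le> v x" if "x \<in> cball z \<epsilon>" for x
      proof -
        have "x \<in> ?K" "dist x z < d" using that sub \<epsilon> by (auto simp: dist_commute)
        from d(2)[OF this] have "\<bar>v x - v z\<bar> < v z / 2" by (simp add: dist_real_def)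
        then show ?thesis by linarith
      qed
      have \<phi>0: "?\<phi> x = 0" if "x \<notin> ?K" for x
        using that sq_ge_outside[of \<rho> e x z] \<rho> e by (intro bubble_eq_0) auto
      have \<phi>C: "Ck_on (2 * m) ?\<phi> UNIV" by (rule Ck_on_bubble[OF e])
      have \<phi>c: "continuous_on X ?\<phi>" for X
        using Ck_on_imp_continuous[OF \<phi>C] continuous_on_subset by blast
      have L\<phi>c: "continuous_on ?K ((laplacian ^^ m) ?\<phi>)"
        using Ck_on_laplacian_funpow[of UNIV 0 m ?\<phi>] \<phi>C continuous_on_subset by (auto simp: Ck_on_0)
      have L\<phi>0: "(laplacian ^^ m) ?\<phi> x = 0" if "x \<notin> ?K" for x
        by (rule laplacian_funpow_zero_off[OF closed_cball \<phi>0 that])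
      have green: "integral\<^sup>L lborel (\<lambda>x. v x * (laplacian ^^ m) ?\<phi> x)
          = integral\<^sup>L lborel (\<lambda>x. ?\<phi> x * (laplacian ^^ m) v x)"
        by (rule green_formula_iter[OF S(1) v \<phi>C compact_cball S(2) \<phi>0])
      then have green: "integral\<^sup>L lborel (\<lambda>x. v x * (- (laplacian ^^ m) ?\<phi> x))
          = integral\<^sup>L lborel (\<lambda>x. ?\<phi> x * f x)"
        by (simp add: f_def)
      have int1: "integrable lborel (\<lambda>x. v x * (- (laplacian ^^ m) ?\<phi> x))"
        by (rule integrable_compact_support[of ?K])
          (use L\<phi>0 L\<phi>c cv in \<open>auto intro!: continuous_intros\<close>)
      have int2: "integrable lborel (\<lambda>x. ?\<phi> x * f x)"
        by (rule integrable_compact_support[of ?K])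
          (use \<phi>0 \<phi>c cf in \<open>auto intro!: continuous_intros\<close>)
      have cs: "continuous_on X (\<lambda>x. sq z e x powr p)" for X
      proof -
        have "sq z e x \<noteq> 0" for x using sq_pos[OF e, of z x] by simp
        then show ?thesis by (intro continuous_intros continuous_on_sq) auto
      qed
      \<comment> \<open>Chosen so that w times the volume of \<open>cball z \<epsilon>\<close>
        equals \<open>c * v z\<close>, whatever \<epsilon> is.\<close>
      define w where "w = \<kappa> * (2 powr (- real m - real ?n / 2) / \<epsilon> ^ ?n) * (v z / 2)"
      have intw: "integrable lborel (\<lambda>x. indicator (cball z \<epsilon>) x * w)"
        by (intro integrable_indicator_mult continuous_intros compact_cball)
      have lower: "indicator (cball z \<epsilon>) x * w - B / \<rho> ^ ?n * (indicator ?K x * v x)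
        \<le> v x * (- (laplacian ^^ m) ?\<phi> x)" for x
      proof (cases "x \<in> ?K")
        case False
        then have "x \<notin> cball z \<epsilon>" using sub by blast
        with False show ?thesis using L\<phi>0[of x] by simp
      next
        case K: True
        then have vx: "0 \<le> v x" using h by blast
        show ?thesis
        proof (cases "x \<in> cball z \<epsilon>")
          case True
          have s2: "sq z e x \<le> 2 * e" using sq_le_iff_cball[of \<epsilon> z e x] True \<epsilon> by (simp add: e_def)
          have g: "\<kappa> * (e ^ m * sq z e x powr (- real m - real ?n / 2)) - B / \<rho> ^ ?n
            \<le> - (laplacian ^^ m) ?\<phi> x"
            using bub[OF \<rho> e, of z x] e e2 s2 by auto
          have "2 powr (- real m - real ?n / 2) / \<epsilon> ^ ?n = e ^ m * (2 * e) powr (- real m - real ?n / 2)"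
          proof -
            have "e powr (- real m - real ?n / 2) = e powr (- real m) * e powr (- (real ?n / 2))"
              by (simp flip: powr_add)
            also have "e powr (- real m) = 1 / e ^ m"
              using e by (simp add: powr_minus_divide powr_realpow)
            also have "e powr (- (real ?n / 2)) = 1 / \<epsilon> ^ ?n"
            proof -
              have "e powr (real ?n / 2) = \<epsilon> ^ ?n"
                using \<epsilon>(1) by (simp add: e_def powr_powr powr_realpow flip: powr_numeral)
              then show ?thesis by (simp add: powr_minus_divide)
            qed
            finally show ?thesis using e by (simp add: powr_mult)
          qed
          also have "\<dots> \<le> e ^ m * sq z e x powr (- real m - real ?n / 2)"
            using e s2 sq_pos[OF e] by (intro mult_left_mono powr_mono2') auto
          finally have "\<kappa> * (2 powr (- real m - real ?n / 2) / \<epsilon> ^ ?n) * (v z / 2)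
            \<le> \<kappa> * (e ^ m * sq z e x powr (- real m - real ?n / 2)) * v x"
            using \<kappa> vhalf[OF True] vz \<epsilon> e by (intro mult_mono mult_left_mono) auto
          then have "w - B / \<rho> ^ ?n * v x
            \<le> v x * (\<kappa> * (e ^ m * sq z e x powr (- real m - real ?n / 2)) - B / \<rho> ^ ?n)"
            by (simp add: w_def algebra_simps)
          also have "\<dots> \<le> v x * (- (laplacian ^^ m) ?\<phi> x)"
            by (rule mult_left_mono[OF g vx])
          finally show ?thesis using True K by simp
        next
          case False
          have "v x * (- (B / \<rho> ^ ?n)) \<le> v x * (- (laplacian ^^ m) ?\<phi> x)"
            using bub[OF \<rho> e, of z x] e e2 vx by (intro mult_left_mono) auto
          then show ?thesis using False K by (simp add: mult.commute)
        qed
      qed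
      \<comment> \<open>Inside radius r, f is replaced by L and the kernel s^p is kept; outside, the
        kernel is replaced by its bound r^(2p) and f is kept.\<close>
      have upper: "?\<phi> x * f x \<le> L * (indicator (cball z r) x * sq z e x powr p)
         + (r\<^sup>2) powr p * (indicator ?K x * f x)" for x
      proof (cases "x \<in> ?K")
        case False
        then show ?thesis using \<phi>0[of x] L by simp
      next
        case K: True
        then have fx: "0 \<le> f x" "f x \<le> L" using h by (auto simp: f_def)
        have b: "?\<phi> x \<le> sq z e x powr p" unfolding p_def using e by (intro bubble_le) simp
        show ?thesis
        proof (cases "x \<in> cball z r")
          case True
          have "?\<phi> x * f x \<le> sq z e x powr p * L"
            using b fx bubble_nonneg by (intro mult_mono) auto
          moreover have "0 \<le> (r\<^sup>2) powr p * f x" using fx by simp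
          ultimately show ?thesis using True K by (simp add: mult.commute)
        next
          case False
          have "sq z e x powr p \<le> (r\<^sup>2) powr p"
            using sq_ge_outside[of r e x z] False r e p by (intro powr_mono2') auto
          then have "?\<phi> x * f x \<le> (r\<^sup>2) powr p * f x"
            using b fx by (intro mult_right_mono) auto
          then show ?thesis using False K by simp
        qed
      qed
      have ints: "integrable lborel (\<lambda>x. indicator (cball z r) x * sq z e x powr p)"
        by (intro integrable_indicator_mult cs compact_cball)
      have "w * (V * \<epsilon> ^ ?n) - B / \<rho> ^ ?n * A
        = integral\<^sup>L lborel (\<lambda>x. indicator (cball z \<epsilon>) x * w - B / \<rho> ^ ?n * (indicator ?K x * v x))"
        using integral_indicator_cball[of \<epsilon> z w] \<epsilon>(1) intv intw
        by (subst Bochner_Integration.integral_diff) (auto simp: A_def V_def)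
      also have "\<dots> \<le> integral\<^sup>L lborel (\<lambda>x. v x * (- (laplacian ^^ m) ?\<phi> x))"
        by (intro integral_mono lower int1) (use intv intw in auto)
      also have "\<dots> = integral\<^sup>L lborel (\<lambda>x. ?\<phi> x * f x)" by (rule green)
      also have "\<dots> \<le> integral\<^sup>L lborel (\<lambda>x. L * (indicator (cball z r) x * sq z e x powr p)
         + (r\<^sup>2) powr p * (indicator ?K x * f x))"
        by (intro integral_mono upper int2) (use ints intf in auto)
      also have "\<dots> = L * integral\<^sup>L lborel (\<lambda>x. indicator (cball z r) x * sq z e x powr p)
         + (r\<^sup>2) powr p * integral\<^sup>L lborel (\<lambda>x. indicator ?K x * f x)"
        using ints intf by (subst Bochner_Integration.integral_add) auto
      also have "\<dots> \<le> L * (D * r ^ (2 * m)) + (r\<^sup>2) powr p * I"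
        using D(2)[OF e r, of z] I L by (intro add_mono mult_left_mono) (auto simp: f_def)
      finally have "w * (V * \<epsilon> ^ ?n) \<le> B * (A / \<rho> ^ ?n) + D * (L * r ^ (2 * m)) + 1 * ((r\<^sup>2) powr p * I)"
        by (simp add: algebra_simps)
      also have "\<dots> \<le> (B + D + 1) * (A / \<rho> ^ ?n) + (B + D + 1) * (L * r ^ (2 * m)) + (B + D + 1) * ((r\<^sup>2) powr p * I)"
        using B D Qi by (intro add_mono mult_right_mono) auto
      also have "w * (V * \<epsilon> ^ ?n) = c * v z"
        using \<epsilon>(1) by (simp add: w_def c_def)
      finally show ?thesis
        using c by (simp add: C_def field_simps)
    qed
  qed
  then show ?thesis unfolding p_def using C by blast
qed

subsection \<open>Integral estimates on annuli\<close>

text \<open>A radial step from 0 on |y|^2 <= 1/2 to 1 on |y| >= 1. Nested truncated powers give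
  finite smoothness at both transitions, which is all that is needed.\<close>

definition annulus_cutoff :: "nat \<Rightarrow> real^'n::finite \<Rightarrow> real" where
  "annulus_cutoff N y = 1 - max 0 (1 - max 0 (2 * sq 0 0 y - 1) ^ N) ^ N"

lemma annulus_cutoff_nonneg: "0 \<le> annulus_cutoff N y"
proof -
  have "max 0 (1 - max 0 (2 * sq 0 0 y - 1) ^ N) ^ N \<le> 1 ^ N" by (intro power_mono) auto
  then show ?thesis by (simp add: annulus_cutoff_def)
qed

lemma annulus_cutoff_eq_1:
  assumes "1 \<le> sq 0 0 y" "0 < N" shows "annulus_cutoff N y = 1"
proof -
  have "1 \<le> max 0 (2 * sq 0 0 y - 1) ^ N" using assms by (intro one_le_power) auto
  then show ?thesis using assms(2) by (simp add: annulus_cutoff_def max_absorb1)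
qed

lemma annulus_cutoff_eq_0:
  assumes "sq 0 0 y \<le> 1 / 2" "0 < N" shows "annulus_cutoff N y = 0"
  using assms by (simp add: annulus_cutoff_def max_absorb1 power_0_left)

lemma Ck_on_annulus_cutoff:
  assumes "open S" "k < N" shows "Ck_on k (annulus_cutoff N) S"
proof -
  have "Ck_on k (\<lambda>y. 1 + (- 1) * (\<lambda>t. max 0 t ^ N) (1 + (- 1) * (\<lambda>t. max 0 t ^ N) (2 * sq 0 0 y + (- 1)))) S"
    by (intro Ck_on_add Ck_on_mult Ck_on_const Ck_on_sq assms
        Ck_on_compose[where h = "\<lambda>t. max 0 t ^ N", OF _ _ CkR_pos_part_power]) (use assms in auto)
  then show ?thesis
    by (rule Ck_on_cong[OF assms(1), rotated]) (simp add: annulus_cutoff_def)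
qed

text \<open>The power is r^(2-n), the fundamental solution profile, whose exponent is the borderline
  one for the cone.\<close>

definition annulus_test :: "nat \<Rightarrow> real \<Rightarrow> real^'n::finite \<Rightarrow> real" where
  "annulus_test N R y = annulus_cutoff N y *
     (sq 0 0 y powr (- real (CARD('n) - 2) / 2) * max 0 (1 - sqrt (sq 0 0 y) / R) ^ N)"

lemma sq_0_0: "sq 0 0 y = (norm y)\<^sup>2" "sqrt (sq 0 0 y) = norm y"
  by (simp_all add: sq_def)

lemma annulus_test_nonneg: "0 \<le> annulus_test N R y"
  by (simp add: annulus_test_def annulus_cutoff_nonneg)

lemma annulus_test_eq_0_outside:
  assumes "0 < R" "0 < N" "R \<le> norm y" shows "annulus_test N R y = 0"
  using assms by (simp add: annulus_test_def sq_0_0 max_absorb1)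

lemma annulus_test_eq_0_inside:
  assumes "0 < N" "sq 0 0 y \<le> 1 / 2" shows "annulus_test N R y = 0"
  using annulus_cutoff_eq_0[OF assms(2,1)] by (simp add: annulus_test_def)

text \<open>Compact set carrying the test function; its inner radius 1/sqrt 2 exceeds 1/2, so it
  lies inside the domain of v.\<close>

definition annulus_hull :: "real \<Rightarrow> (real^'n::finite) set" where
  "annulus_hull R = {y. 1 / 2 \<le> sq 0 0 y} \<inter> cball 0 R"

lemma compact_annulus_hull: "compact (annulus_hull R)"
  unfolding annulus_hull_def
  by (intro closed_Int_compact closed_Collect_le continuous_on_sq continuous_on_const compact_cball)

lemma annulus_hull_subset: "annulus_hull R \<subseteq> {y. 1 / 2 < norm y}"
proof
  fix y :: "real^'n" assume "y \<in> annulus_hull R"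
  then have "(1 / 2)\<^sup>2 < (norm y)\<^sup>2" by (simp add: annulus_hull_def sq_0_0 power2_eq_square)
  then show "y \<in> {y. 1 / 2 < norm y}" using power2_less_imp_less[of "1 / 2" "norm y"] by simp
qed

text \<open>The powers of |y| are singular only at the origin, near which the cut-off makes the
  product vanish; gluing with zero does the rest.\<close>

lemma Ck_on_annulus_test:
  assumes R: "0 < R" and kN: "k < N" shows "Ck_on k (annulus_test N R) (UNIV :: (real^'n::finite) set)"
proof -
  let ?S = "{y :: real^'n. 0 < sq 0 0 y}" and ?p = "- real (CARD('n) - 2) / 2"
  have "Ck_on k (\<lambda>y. annulus_cutoff N y * (sq 0 0 y powr ?p * (\<lambda>t. max 0 t ^ N) (1 + (- 1 / R) * sq 0 0 y powr (1 / 2)))) ?S"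
    by (intro Ck_on_mult Ck_on_compose[where h = "\<lambda>t. max 0 t ^ N", OF _ _ CkR_pos_part_power] Ck_on_add
        Ck_on_const Ck_on_sq_powr open_sq_pos Ck_on_annulus_cutoff kN) auto
  then have S: "Ck_on k (annulus_test N R) ?S"
    by (rule Ck_on_cong[OF open_sq_pos, rotated]) (simp add: annulus_test_def powr_half_sqrt)
  show ?thesis
  proof (rule Ck_on_UNIV_zero_off[OF open_sq_pos _ compact_imp_closed[OF compact_annulus_hull[of R]] _ S])
    show "annulus_hull R \<subseteq> ?S" by (auto simp: annulus_hull_def)
    show "annulus_test N R y = 0" if "y \<notin> annulus_hull R" for y :: "real^'n"
      using that annulus_test_eq_0_inside[of N y R] annulus_test_eq_0_outside[of R N y] R kN
      by (auto simp: annulus_hull_def not_le)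
  qed
qed

text \<open>Isolates R in the coefficients (-1/R)^j, leaving finitely many functions independent of
  R.\<close>

lemma annulus_test_expand:
  fixes y :: "real^'n::finite"
  assumes "0 < R" "0 < sq 0 0 y" "sq 0 0 y < R\<^sup>2"
  shows "annulus_test N R y = (\<Sum>j\<le>N. (real (N choose j) * (- 1 / R) ^ j)
    * (annulus_cutoff N y * sq 0 0 y powr (- real (CARD('n) - 2) / 2 + real j / 2)))"
proof -
  let ?s = "sq 0 0 y" and ?p = "- real (CARD('n) - 2) / 2"
  have "norm y < R" using assms power2_less_imp_less[of "norm y" R] by (simp add: sq_0_0)
  then have "max 0 (1 - sqrt ?s / R) = (- 1 / R) * sqrt ?s + 1"
    using assms(1) by (simp add: sq_0_0)
  then have "annulus_test N R y = annulus_cutoff N y * (?s powr ?p * ((- 1 / R) * sqrt ?s + 1) ^ N)"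
    by (simp add: annulus_test_def)
  also have "\<dots> = annulus_cutoff N y * (?s powr ?p * (\<Sum>j\<le>N. real (N choose j) * ((- 1 / R) * sqrt ?s) ^ j * 1 ^ (N - j)))"
    by (subst binomial_ring) simp
  also have "\<dots> = (\<Sum>j\<le>N. (real (N choose j) * (- 1 / R) ^ j) * (annulus_cutoff N y * (?s powr ?p * sqrt ?s ^ j)))"
    unfolding sum_distrib_left power_mult_distrib by (intro sum.cong refl) (simp only: power_one mult_1_right mult_ac)
  also have "\<dots> = (\<Sum>j\<le>N. (real (N choose j) * (- 1 / R) ^ j) * (annulus_cutoff N y * ?s powr (?p + real j / 2)))"
  proof (intro sum.cong refl)
    fix j
    have "?s powr (real j / 2) = sqrt ?s ^ j"
      using assms(2) by (simp add: powr_powr flip: powr_half_sqrt powr_realpow)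
    then show "(real (N choose j) * (- 1 / R) ^ j) * (annulus_cutoff N y * (?s powr ?p * sqrt ?s ^ j))
      = (real (N choose j) * (- 1 / R) ^ j) * (annulus_cutoff N y * ?s powr (?p + real j / 2))"
      unfolding powr_add by simp
  qed
  finally show ?thesis .
qed

text \<open>The R-free functions of the expansion have bounded \<Delta>^m on a compact annulus, and
  for R >= 2 the powers of 1/R are at most one.\<close>

lemma laplacian_funpow_annulus_test_bound:
  "\<exists>B\<ge>0. \<forall>R\<ge>2. \<forall>y :: real^'n::finite. 1 / 2 \<le> sq 0 0 y \<longrightarrow> sq 0 0 y \<le> 1 \<longrightarrow>
    \<bar>(laplacian ^^ m) (annulus_test (2 * m + 1) R) y\<bar> \<le> B"
proof -
  define N where "N = 2 * m + 1"
  let ?p = "- real (CARD('n) - 2) / 2" and ?S = "{y :: real^'n. 0 < sq 0 0 y}"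
  define A where "A = {y :: real^'n. 1 / 2 \<le> sq 0 0 y \<and> sq 0 0 y \<le> 1}"
  define \<psi> where "\<psi> j y = annulus_cutoff N y * sq 0 0 y powr (?p + real j / 2)" for j and y :: "real^'n"
  have AS: "A \<subseteq> ?S" by (auto simp: A_def)
  have "A = annulus_hull 1"
    by (auto simp: A_def annulus_hull_def sq_0_0 abs_square_le_1)
  then have "compact A" by (simp add: compact_annulus_hull)
  have \<psi>: "Ck_on (2 * m) (\<psi> j) ?S" for j
    unfolding \<psi>_def by (intro Ck_on_mult Ck_on_annulus_cutoff Ck_on_sq_powr open_sq_pos) (auto simp: N_def)
  have "\<exists>b\<ge>0. \<forall>y\<in>A. \<bar>(laplacian ^^ m) (\<psi> j) y\<bar> \<le> b" for j
  proof -
    have "continuous_on A ((laplacian ^^ m) (\<psi> j))"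
      using Ck_on_laplacian_funpow[OF open_sq_pos, of 0 m "\<psi> j" 0 0] \<psi> AS continuous_on_subset
      by (auto simp: Ck_on_0)
    then have "bounded ((laplacian ^^ m) (\<psi> j) ` A)"
      using \<open>compact A\<close> by (intro compact_imp_bounded compact_continuous_image)
    then show ?thesis unfolding bounded_pos using less_imp_le by fastforce
  qed
  then obtain b where b: "\<And>j. b j \<ge> 0" "\<And>j y. y \<in> A \<Longrightarrow> \<bar>(laplacian ^^ m) (\<psi> j) y\<bar> \<le> b j"
    by metis
  define B where "B = (\<Sum>j\<le>N. real (N choose j) * b j)"
  have "\<bar>(laplacian ^^ m) (annulus_test N R) y\<bar> \<le> B" if R: "2 \<le> R" and y: "y \<in> A" for R y
  proof -
    have "open {y :: real^'n. 0 < sq 0 0 y \<and> sq 0 0 y < R\<^sup>2}"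
      by (intro open_Collect_conj open_Collect_less continuous_on_sq continuous_on_const)
    moreover have "2 ^ 2 \<le> R\<^sup>2" using R by (intro power_mono) auto
    then have "y \<in> {y. 0 < sq 0 0 y \<and> sq 0 0 y < R\<^sup>2}" using y by (auto simp: A_def)
    ultimately have "(laplacian ^^ m) (annulus_test N R) y
      = (laplacian ^^ m) (\<lambda>y. \<Sum>j\<le>N. (real (N choose j) * (- 1 / R) ^ j) * \<psi> j y) y"
      by (rule laplacian_funpow_cong) (use R in \<open>auto simp: annulus_test_expand \<psi>_def\<close>)
    also have "\<dots> = (\<Sum>j\<le>N. (real (N choose j) * (- 1 / R) ^ j) * (laplacian ^^ m) (\<psi> j) y)"
      by (rule laplacian_funpow_sum[OF open_sq_pos[of 0 0]]) (use \<psi> y AS in auto)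
    also have "\<bar>\<dots>\<bar> \<le> (\<Sum>j\<le>N. \<bar>(real (N choose j) * (- 1 / R) ^ j) * (laplacian ^^ m) (\<psi> j) y\<bar>)"
      by (rule sum_abs)
    also have "\<dots> \<le> B"
      unfolding B_def
    proof (intro sum_mono)
      fix j
      have "\<bar>- 1 / R\<bar> ^ j \<le> 1" using R by (intro power_le_one) auto
      then have "\<bar>- 1 / R\<bar> ^ j * \<bar>(laplacian ^^ m) (\<psi> j) y\<bar> \<le> 1 * b j"
        using b y by (intro mult_mono) auto
      then have "real (N choose j) * (\<bar>- 1 / R\<bar> ^ j * \<bar>(laplacian ^^ m) (\<psi> j) y\<bar>) \<le> real (N choose j) * (1 * b j)"
        by (rule mult_left_mono) simp
      then show "\<bar>(real (N choose j) * (- 1 / R) ^ j) * (laplacian ^^ m) (\<psi> j) y\<bar> \<le> real (N choose j) * b j"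
        by (simp add: abs_mult power_abs mult.assoc)
    qed
    finally show ?thesis .
  qed
  moreover have "B \<ge> 0" unfolding B_def by (intro sum_nonneg mult_nonneg_nonneg b) auto
  ultimately show ?thesis unfolding N_def A_def by blast
qed

section \<open>Lower bounds for the test function on the annulus\<close>

lemma square_powr_neg_half:
  fixes t :: real
  assumes "0 < t" shows "(t\<^sup>2) powr (- real k / 2) = 1 / t ^ k"
proof -
  have "(t\<^sup>2) powr (- real k / 2) = t powr (- real k)"
    using assms by (simp add: powr_powr flip: powr_numeral)
  then show ?thesis using assms by (simp add: powr_minus_divide powr_realpow)
qed

text \<open>Here the test function coincides with the cone element k = n - 2, j = 2m + 1; after m
  Laplacians one factor 1 - r/R is left.\<close>

lemma laplacian_funpow_annulus_test_ge:
  fixes y :: "real^'n::finite"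
  assumes n: "3 \<le> CARD('n)" and R: "0 < R" and y: "1 < norm y" "norm y < R"
  shows "(laplacian ^^ m) (annulus_test (2 * m + 1) R) y
    \<ge> (1 - norm y / R) / (norm y ^ (CARD('n) - 2) * R ^ (2 * m))"
proof -
  let ?k = "real (CARD('n) - 2)"
  define U where "U = {y :: real^'n. 1 < norm y \<and> norm y < R}"
  have U: "open U" unfolding U_def
    by (intro open_Collect_conj open_Collect_less continuous_intros)
  have y0: "0 < sq 0 0 y" using y by (auto simp: sq_0_0)
  have "radcone R ?k (2 * m + 1 - 2 * m) y / R ^ (2 * m) \<le> (laplacian ^^ m) (radcone R ?k (2 * m + 1)) y"
    by (rule laplacian_funpow_radcone_ge) (use y0 y R n in \<open>auto simp: sq_0_0\<close>)
  also have "(laplacian ^^ m) (radcone R ?k (2 * m + 1)) y = (laplacian ^^ m) (annulus_test (2 * m + 1) R) y"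
  proof (rule laplacian_funpow_cong[OF U])
    fix x assume x: "x \<in> U"
    then have "1 \<le> sq 0 0 x" by (simp add: U_def sq_0_0 one_le_power)
    moreover have "max 0 (1 - norm x / R) = 1 - norm x / R" using x R by (simp add: U_def)
    ultimately show "radcone R ?k (2 * m + 1) x = annulus_test (2 * m + 1) R x"
      by (simp add: radcone_def annulus_test_def annulus_cutoff_eq_1 sq_0_0(2))
  qed (use y in \<open>simp add: U_def\<close>)
  also have "radcone R ?k (2 * m + 1 - 2 * m) y = (1 - norm y / R) / norm y ^ (CARD('n) - 2)"
  proof -
    have "0 < norm y" using y by linarith
    then show ?thesis using square_powr_neg_half[of "norm y" "CARD('n) - 2"] by (simp add: radcone_def sq_0_0)
  qed
  finally show ?thesis by simp
qed

lemma annulus_test_eq: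
  fixes y :: "real^'n::finite"
  assumes R: "0 < R" "0 < N" and y: "1 \<le> norm y" "norm y < R"
  shows "annulus_test N R y = (1 - norm y / R) ^ N / norm y ^ (CARD('n) - 2)"
proof -
  let ?k = "real (CARD('n) - 2)"
  have "1 \<le> sq 0 0 y" using y by (simp add: sq_0_0 one_le_power)
  moreover have "max 0 (1 - norm y / R) = 1 - norm y / R" using y R by simp
  moreover have "((norm y)\<^sup>2) powr (- ?k / 2) = 1 / norm y ^ (CARD('n) - 2)"
    by (rule square_powr_neg_half) (use y in linarith)
  ultimately show ?thesis
    using R(2) by (simp add: annulus_test_def annulus_cutoff_eq_1 sq_0_0)
qed

section \<open>Integral bounds for v and f\<close>

lemma compact_closed_annulus: "compact {y :: 'a::euclidean_space. 1 \<le> norm y \<and> norm y \<le> R}"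
proof -
  have "{y :: 'a. 1 \<le> norm y \<and> norm y \<le> R} = {y. 1 \<le> norm y} \<inter> cball 0 R" by auto
  then show ?thesis
    by (simp add: closed_Int_compact closed_Collect_le continuous_on_norm_id)
qed

text \<open>Green's formula with the test function of outer radius 2R. For |y| > 1 both integrands
  have a favourable sign and can be bounded below up to radius R; the error from |y| <= 1 does not
  depend on R.\<close>

lemma annulus_integral_estimates:
  fixes v :: "real^'n::finite \<Rightarrow> real"
  assumes n: "3 \<le> CARD('n)" and v: "Ck_on (2 * m) v {y. 1 / 2 < norm y}"
    and v0: "\<And>y. 1 / 2 < norm y \<Longrightarrow> 0 \<le> v y"
    and f0: "\<And>y. 1 / 2 < norm y \<Longrightarrow> 0 \<le> - (laplacian ^^ m) v y"
  shows "\<exists>C>0. \<forall>R\<ge>1.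
    integral\<^sup>L lborel (\<lambda>y. indicator {y. 1 \<le> norm y \<and> norm y \<le> R} y * v y) \<le> C * R ^ (CARD('n) - 2 + 2 * m) \<and>
    integral\<^sup>L lborel (\<lambda>y. indicator {y. 1 \<le> norm y \<and> norm y \<le> R} y * (- (laplacian ^^ m) v y)) \<le> C * R ^ (CARD('n) - 2)"
proof -
  let ?S = "{y :: real^'n. 1 / 2 < norm y}"
  define k where "k = CARD('n) - 2"
  define N where "N = 2 * m + 1"
  define f where "f y = - (laplacian ^^ m) v y" for y
  have S: "open ?S" by (intro open_Collect_less continuous_intros)
  obtain B where B0: "B \<ge> 0" and B': "\<forall>R\<ge>2. \<forall>y :: real^'n. 1 / 2 \<le> sq 0 0 y \<longrightarrow> sq 0 0 y \<le> 1 \<longrightarrow>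
    \<bar>(laplacian ^^ m) (annulus_test N R) y\<bar> \<le> B"
    using laplacian_funpow_annulus_test_bound[of m, where 'n = 'n, folded N_def] by (elim exE conjE) (rule that)
  note B = B0 B'[rule_format]
  \<comment> \<open>The mass of v near the inner boundary, the only quantity that pays for the
    cut-off.\<close>
  define M where "M = integral\<^sup>L lborel (\<lambda>y. indicator (annulus_hull 1) y * v y)"
  have cv: "continuous_on X v" if "X \<subseteq> ?S" for X
    using v Ck_on_imp_continuous continuous_on_subset that by blast
  have "continuous_on ?S ((laplacian ^^ m) v)"
    using Ck_on_laplacian_funpow[OF S, of 0 m v] v by (simp add: Ck_on_0)
  then have cf: "continuous_on X f" if "X \<subseteq> ?S" for X
    unfolding f_def using that by (intro continuous_intros) (rule continuous_on_subset)
  have M: "0 \<le> M" unfolding M_def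
    by (rule Bochner_Integration.integral_nonneg) (use annulus_hull_subset[of 1] v0 in \<open>auto simp: indicator_def\<close>)
  \<comment> \<open>The factor 2^N undoes the one in \<open>c\<close> and \<open>c'\<close> below;
    the added 1 keeps C positive even if M is zero.\<close>
  define C where "C = ((B + 1) * M + 1) * 2 ^ N"
  have C: "C > 0" using B M by (simp add: C_def add_nonneg_pos)
  have "integral\<^sup>L lborel (\<lambda>y. indicator {y. 1 \<le> norm y \<and> norm y \<le> R} y * v y) \<le> C * R ^ (k + 2 * m) \<and>
    integral\<^sup>L lborel (\<lambda>y. indicator {y. 1 \<le> norm y \<and> norm y \<le> R} y * f y) \<le> C * R ^ k"
    if R: "1 \<le> R" for R
  proof -
    let ?A = "{y :: real^'n. 1 \<le> norm y \<and> norm y \<le> R}" and ?H = "annulus_hull (2 * R) :: (real^'n) set"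
    let ?\<phi> = "annulus_test N (2 * R) :: real^'n \<Rightarrow> real"
    have AS: "?A \<subseteq> ?S" by auto
    have R2: "0 < 2 * R" "2 \<le> 2 * R" using R by auto
    have N: "0 < N" "2 * m < N" by (auto simp: N_def)
    have \<phi>C: "Ck_on (2 * m) ?\<phi> UNIV" by (rule Ck_on_annulus_test[OF R2(1) N(2)])
    have \<phi>0: "?\<phi> y = 0" if "y \<notin> ?H" for y
      using that annulus_test_eq_0_inside[of N y "2 * R"] annulus_test_eq_0_outside[of "2 * R" N y] R2 N
      by (auto simp: annulus_hull_def not_le)
    have \<phi>c: "continuous_on X ?\<phi>" for X
      using Ck_on_imp_continuous[OF \<phi>C] continuous_on_subset by blast
    have L\<phi>c: "continuous_on X ((laplacian ^^ m) ?\<phi>)" for X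
      using Ck_on_laplacian_funpow[of UNIV 0 m ?\<phi>] \<phi>C continuous_on_subset by (auto simp: Ck_on_0)
    have L\<phi>0: "(laplacian ^^ m) ?\<phi> y = 0" if "y \<notin> ?H" for y
      by (rule laplacian_funpow_zero_off[OF compact_imp_closed[OF compact_annulus_hull] \<phi>0 that])
    have L\<phi>out: "(laplacian ^^ m) ?\<phi> y = 0" if "2 * R \<le> norm y" for y
    proof (rule laplacian_funpow_zero_off_ball[OF \<phi>C])
      show "?\<phi> y = 0" if "y \<notin> cball 0 (2 * R)" for y
        using that by (intro \<phi>0) (simp add: annulus_hull_def)
    qed (use that in simp)
    have "integral\<^sup>L lborel (\<lambda>y. v y * (laplacian ^^ m) ?\<phi> y) = integral\<^sup>L lborel (\<lambda>y. ?\<phi> y * (laplacian ^^ m) v y)"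
      by (rule green_formula_iter[OF S v \<phi>C compact_annulus_hull annulus_hull_subset \<phi>0])
    then have green: "integral\<^sup>L lborel (\<lambda>y. ?\<phi> y * f y) = integral\<^sup>L lborel (\<lambda>y. v y * (- (laplacian ^^ m) ?\<phi> y))"
      by (simp add: f_def)
    have int1: "integrable lborel (\<lambda>y. v y * (- (laplacian ^^ m) ?\<phi> y))"
      by (rule integrable_compact_support[OF compact_annulus_hull[of "2 * R"]])
        (use L\<phi>0 L\<phi>c cv[OF annulus_hull_subset] in \<open>auto intro!: continuous_intros\<close>)
    have int2: "integrable lborel (\<lambda>y. ?\<phi> y * f y)"
      by (rule integrable_compact_support[OF compact_annulus_hull[of "2 * R"]])
        (use \<phi>0 \<phi>c cf[OF annulus_hull_subset] in \<open>auto intro!: continuous_intros\<close>)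
    have intv: "integrable lborel (\<lambda>y. indicator ?A y * v y)"
      by (intro integrable_indicator_mult compact_closed_annulus cv AS)
    have intf: "integrable lborel (\<lambda>y. indicator ?A y * f y)"
      by (intro integrable_indicator_mult compact_closed_annulus cf AS)
    have inth: "integrable lborel (\<lambda>y. indicator (annulus_hull 1) y * v y)"
      by (intro integrable_indicator_mult compact_annulus_hull cv annulus_hull_subset)
    \<comment> \<open>\<open>c\<close> bounds \<Delta>^m of the test function from below on 1 < |y|
      <= R, and \<open>c'\<close> the test function itself on 1 <= |y| <= R; the outer radius 2R
      leaves 1 - |y|/(2R) at least 1/2.\<close>
    define c where "c = 1 / (2 ^ N * R ^ (k + 2 * m))"
    define c' where "c' = 1 / (2 ^ N * R ^ k)"
    have Rk: "1 \<le> R ^ i" for i using R by (rule one_le_power)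
    have cpos: "0 < c" "0 < c'" using R by (auto simp: c_def c'_def)
    have c1: "c \<le> 1"
    proof -
      have "1 * 1 \<le> 2 ^ N * R ^ (k + 2 * m)" by (intro mult_mono Rk one_le_power) auto
      then show ?thesis by (simp add: c_def divide_le_eq)
    qed
    have lowerL: "c \<le> (laplacian ^^ m) ?\<phi> y" if y: "1 < norm y" "norm y \<le> R" for y :: "real^'n"
    proof -
      have "c = (1 / 2) / (R ^ k * (2 * R) ^ (2 * m))"
        by (simp add: c_def N_def power_add power_mult_distrib field_simps)
      also have "\<dots> \<le> (1 - norm y / (2 * R)) / (norm y ^ k * (2 * R) ^ (2 * m))"
        using y R by (intro frac_le mult_right_mono power_mono mult_pos_pos zero_less_power) (auto simp: field_simps)
      also have "\<dots> \<le> (laplacian ^^ m) ?\<phi> y"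
        unfolding N_def k_def using y R by (intro laplacian_funpow_annulus_test_ge n) auto
      finally show ?thesis .
    qed
    have nonnegL: "0 \<le> (laplacian ^^ m) ?\<phi> y" if y: "1 < norm y" for y
    proof (cases "norm y < 2 * R")
      case True
      have "0 \<le> (1 - norm y / (2 * R)) / (norm y ^ k * (2 * R) ^ (2 * m))"
        using y R True by (intro divide_nonneg_nonneg mult_nonneg_nonneg) auto
      also have "\<dots> \<le> (laplacian ^^ m) ?\<phi> y"
        unfolding N_def k_def using y R True by (intro laplacian_funpow_annulus_test_ge n) auto
      finally show ?thesis .
    next
      case False
      then show ?thesis using L\<phi>out by simp
    qed
    have lower\<phi>: "c' \<le> ?\<phi> y" if y: "1 \<le> norm y" "norm y \<le> R" for y :: "real^'n"
    proof -
      have "c' = (1 / 2) ^ N / R ^ k" by (simp add: c'_def power_divide)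
      also have "\<dots> \<le> (1 - norm y / (2 * R)) ^ N / norm y ^ k"
        using y R by (intro frac_le power_mono zero_less_power zero_le_power) (auto simp: field_simps)
      also have "\<dots> = ?\<phi> y" unfolding k_def using y R N by (intro annulus_test_eq[symmetric]) auto
      finally show ?thesis .
    qed
    \<comment> \<open>The sphere |y| = 1 lies in both sets, and the lower bound \<open>c\<close> is
      available only for |y| > 1. Using B + 1 instead of B absorbs the overlap, since c <=
      1.\<close>
    have p1: "v y * (- (laplacian ^^ m) ?\<phi> y) \<le> (B + 1) * (indicator (annulus_hull 1) y * v y) - c * (indicator ?A y * v y)" for y
    proof (cases "y \<in> annulus_hull (2 * R)")
      case False
      have "annulus_hull 1 \<subseteq> ?H" using R by (auto simp: annulus_hull_def)
      moreover have "?A \<subseteq> ?H"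
      proof
        fix x assume x: "x \<in> ?A"
        then have "1 \<le> (norm x)\<^sup>2" by (intro one_le_power) auto
        then have "1 / 2 \<le> sq 0 0 x" unfolding sq_0_0 by linarith
        then show "x \<in> ?H" unfolding annulus_hull_def using x R by auto
      qed
      ultimately have "y \<notin> ?A" "y \<notin> annulus_hull 1" using False by blast+
      then show ?thesis using L\<phi>0[OF False] by simp
    next
      case H: True
      then have vy: "0 \<le> v y" using annulus_hull_subset v0 by blast
      show ?thesis
      proof (cases "norm y \<le> 1")
        case True
        then have h1: "y \<in> annulus_hull 1" using H by (simp add: annulus_hull_def)
        have s1: "1 / 2 \<le> sq 0 0 y" "sq 0 0 y \<le> 1"
          using H True by (auto simp: annulus_hull_def sq_0_0 power_le_one)
        have "- (laplacian ^^ m) ?\<phi> y \<le> B" using B(2)[OF R2(2) s1] by linarith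
        moreover have "c * indicator ?A y \<le> 1" using c1 by (auto simp: indicator_def)
        ultimately have "- (laplacian ^^ m) ?\<phi> y \<le> (B + 1) - c * indicator ?A y" by linarith
        then have "v y * (- (laplacian ^^ m) ?\<phi> y) \<le> v y * ((B + 1) - c * indicator ?A y)"
          by (rule mult_left_mono) (rule vy)
        then show ?thesis using h1 by (simp add: algebra_simps)
      next
        case False
        then have h1: "y \<notin> annulus_hull 1" by (simp add: annulus_hull_def)
        have "c * indicator ?A y \<le> (laplacian ^^ m) ?\<phi> y"
          using lowerL[of y] nonnegL[of y] False by (auto simp: indicator_def)
        then have "v y * (c * indicator ?A y) \<le> v y * (laplacian ^^ m) ?\<phi> y"
          by (rule mult_left_mono) (rule vy)
        then show ?thesis using h1 by (simp add: algebra_simps)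
      qed
    qed
    have p2: "c' * (indicator ?A y * f y) \<le> ?\<phi> y * f y" for y
    proof (cases "y \<in> ?A")
      case True
      then have "0 \<le> f y" using f0[of y] by (simp add: f_def)
      with lower\<phi>[of y] True show ?thesis by (simp add: mult_right_mono)
    next
      case False
      have "0 \<le> ?\<phi> y * f y"
      proof (cases "y \<in> ?H")
        case True
        then have "0 \<le> f y" using annulus_hull_subset f0 by (auto simp: f_def)
        then show ?thesis by (intro mult_nonneg_nonneg annulus_test_nonneg)
      qed (use \<phi>0 in simp)
      then show ?thesis using False by simp
    qed
    define Iv where "Iv = integral\<^sup>L lborel (\<lambda>y. indicator ?A y * v y)"
    define If where "If = integral\<^sup>L lborel (\<lambda>y. indicator ?A y * f y)"
    have Iv: "0 \<le> Iv" unfolding Iv_def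
      by (rule Bochner_Integration.integral_nonneg) (use v0 in \<open>auto simp: indicator_def\<close>)
    have If: "0 \<le> If" unfolding If_def
      by (rule Bochner_Integration.integral_nonneg) (use f0 in \<open>auto simp: indicator_def f_def\<close>)
    have "c' * If \<le> integral\<^sup>L lborel (\<lambda>y. ?\<phi> y * f y)"
      unfolding If_def
      by (subst Bochner_Integration.integral_mult_right_zero[symmetric]) (intro integral_mono p2 int2 integrable_mult_right intf)
    also have "\<dots> \<le> integral\<^sup>L lborel (\<lambda>y. (B + 1) * (indicator (annulus_hull 1) y * v y) - c * (indicator ?A y * v y))"
      unfolding green
      by (intro integral_mono p1 int1 Bochner_Integration.integrable_diff integrable_mult_right inth intv)
    also have "\<dots> = (B + 1) * M - c * Iv"
      unfolding M_def Iv_def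
      by (subst Bochner_Integration.integral_diff) (use inth intv in auto)
    finally have main: "c' * If + c * Iv \<le> (B + 1) * M" by linarith
    \<comment> \<open>Both summands on the left are nonnegative, so each is bounded separately by
      the R-independent right-hand side.\<close>
    have "c * Iv \<le> (B + 1) * M + 1" "c' * If \<le> (B + 1) * M + 1"
      using main mult_nonneg_nonneg[of c Iv] mult_nonneg_nonneg[of c' If] Iv If cpos by linarith+
    then have "Iv \<le> C * R ^ (k + 2 * m)" "If \<le> C * R ^ k"
      using R by (simp_all add: c_def c'_def C_def divide_le_eq mult_ac)
    then show ?thesis unfolding Iv_def If_def ..
  qed
  then show ?thesis using C unfolding k_def f_def by blast
qed

subsection \<open>The growth bound\<close>

text \<open>For Y > 1 the constant a is at most a Y^\<theta>, so dividing by Y^\<theta> gives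
  Y^(1-\<theta>) <= a + c.\<close>

lemma sublinear_bound:
  fixes a c \<theta> Y :: real
  assumes "0 < \<theta>" "\<theta> < 1" "0 \<le> a" "0 \<le> c" "Y \<le> a + c * Y powr \<theta>"
  shows "Y \<le> max 1 ((a + c) powr (1 / (1 - \<theta>)))"
proof (cases "Y \<le> 1")
  case False
  then have Y: "1 < Y" by simp
  have p: "1 \<le> Y powr \<theta>" using Y assms(1) by (intro ge_one_powr_ge_zero) auto
  have "Y \<le> a * Y powr \<theta> + c * Y powr \<theta>"
    using assms(5) mult_left_mono[OF p assms(3)] by simp
  then have "Y \<le> (a + c) * Y powr \<theta>" by (simp add: algebra_simps)
  moreover have "Y = Y powr (1 - \<theta>) * Y powr \<theta>" using Y by (simp flip: powr_add)
  ultimately have "Y powr (1 - \<theta>) \<le> a + c"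
    using p by (smt (verit) mult_le_cancel_right)
  then have "(Y powr (1 - \<theta>)) powr (1 / (1 - \<theta>)) \<le> (a + c) powr (1 / (1 - \<theta>))"
    using assms(2) by (intro powr_mono2) auto
  then show ?thesis using Y assms(2) by (simp add: powr_powr)
qed auto

text \<open>The radius at which the near part and the far part of the potential have the same size.\<close>

lemma balancing_radius:
  fixes R M \<sigma> N :: real
  assumes "0 < R" "0 < M" "0 < N"
  defines "r \<equiv> R powr ((N - 2) / N) * M powr (- \<sigma> / N)"
  shows "0 < r"
    and "M powr \<sigma> * r ^ (2 * m) = M powr (\<sigma> * (N - 2 * real m) / N) * R powr (2 * real m * (N - 2) / N)"
    and "(r\<^sup>2) powr (real m - N / 2) * R powr (N - 2)
      = M powr (\<sigma> * (N - 2 * real m) / N) * R powr (2 * real m * (N - 2) / N)"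
proof -
  show r: "0 < r" using assms by (simp add: r_def)
  have pw: "r powr s = R powr ((N - 2) / N * s) * M powr (- \<sigma> / N * s)" for s
    using assms by (simp add: r_def powr_mult powr_powr)
  have "M powr \<sigma> * r ^ (2 * m) = M powr \<sigma> * r powr real (2 * m)"
    using r by (simp only: powr_realpow)
  also have "\<dots> = (M powr \<sigma> * M powr (- \<sigma> / N * real (2 * m))) * R powr ((N - 2) / N * real (2 * m))"
    unfolding pw by simp
  also have "\<dots> = M powr (\<sigma> + - \<sigma> / N * real (2 * m)) * R powr ((N - 2) / N * real (2 * m))"
    by (simp only: powr_add)
  also have "\<sigma> + - \<sigma> / N * real (2 * m) = \<sigma> * (N - 2 * real m) / N"
    using assms(3) by (simp add: field_simps)
  also have "(N - 2) / N * real (2 * m) = 2 * real m * (N - 2) / N" by simp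
  finally show "M powr \<sigma> * r ^ (2 * m) = M powr (\<sigma> * (N - 2 * real m) / N) * R powr (2 * real m * (N - 2) / N)" .
  have "(r\<^sup>2) powr (real m - N / 2) = r powr (2 * (real m - N / 2))"
    using r by (simp add: powr_powr flip: powr_numeral)
  then have "(r\<^sup>2) powr (real m - N / 2) * R powr (N - 2)
    = M powr (- \<sigma> / N * (2 * (real m - N / 2))) * (R powr ((N - 2) / N * (2 * (real m - N / 2))) * R powr (N - 2))"
    unfolding pw by simp
  also have "\<dots> = M powr (- \<sigma> / N * (2 * (real m - N / 2))) * R powr ((N - 2) / N * (2 * (real m - N / 2)) + (N - 2))"
    by (simp only: powr_add)
  also have "- \<sigma> / N * (2 * (real m - N / 2)) = \<sigma> * (N - 2 * real m) / N"
    using assms(3) by (simp add: field_simps)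
  also have "(N - 2) / N * (2 * (real m - N / 2)) + (N - 2) = 2 * real m * (N - 2) / N"
    using assms(3) by (simp add: field_simps)
  finally show "(r\<^sup>2) powr (real m - N / 2) * R powr (N - 2)
      = M powr (\<sigma> * (N - 2 * real m) / N) * R powr (2 * real m * (N - 2) / N)" .
qed

text \<open>Doubling argument: z maximises (\<rho> - |x - y|)^k W x and d is its distance to the
  boundary sphere. Within d/2 of z the distance to the boundary is at least d/2, so W exceeds W z by
  at most the factor 2^k.\<close>

lemma max_weighted_ball:
  fixes W :: "real^'n::finite \<Rightarrow> real"
  assumes R: "0 < \<rho>" and c: "continuous_on (cball y \<rho>) W" and pos: "\<And>x. x \<in> cball y \<rho> \<Longrightarrow> 0 < W x"
    and k: "0 < k"
  obtains z d where "0 < d" "d \<le> \<rho>" "cball z (d / 2) \<subseteq> cball y \<rho>" "z \<in> cball y \<rho>"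
    "\<And>x. x \<in> cball z (d / 2) \<Longrightarrow> W x \<le> 2 ^ k * W z" "\<rho> ^ k * W y \<le> d ^ k * W z"
proof -
  define \<omega> where "\<omega> x = (\<rho> - dist y x) ^ k * W x" for x
  have "continuous_on (cball y \<rho>) \<omega>" unfolding \<omega>_def by (intro continuous_intros c)
  then obtain z where z: "z \<in> cball y \<rho>" "\<And>x. x \<in> cball y \<rho> \<Longrightarrow> \<omega> x \<le> \<omega> z"
    using continuous_attains_sup[of "cball y \<rho>" \<omega>] R by (auto simp: compact_cball)
  define d where "d = \<rho> - dist y z"
  have y: "y \<in> cball y \<rho>" using R by simp
  have wy: "\<rho> ^ k * W y \<le> d ^ k * W z" using z(2)[OF y] by (simp add: \<omega>_def d_def)
  have "0 < \<rho> ^ k * W y" using R pos[OF y] by simp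
  \<comment> \<open>As k > 0, the weight vanishes on the boundary sphere, whereas the maximum is
    positive.\<close>
  then have "d \<noteq> 0" using wy k by (auto simp: power_0_left)
  then have d: "0 < d" "d \<le> \<rho>" using z(1) by (auto simp: d_def)
  have sub: "d / 2 \<le> \<rho> - dist y x" if "x \<in> cball z (d / 2)" for x
    using that dist_triangle[of y x z] by (auto simp: d_def)
  then have sub': "cball z (d / 2) \<subseteq> cball y \<rho>" using d by force
  have "W x \<le> 2 ^ k * W z" if x: "x \<in> cball z (d / 2)" for x
  proof -
    have Wx: "0 < W x" using pos sub' x by blast
    have "(d / 2) ^ k * W x \<le> (\<rho> - dist y x) ^ k * W x"
      using sub[OF x] d Wx by (intro mult_right_mono power_mono) auto
    also have "\<dots> \<le> d ^ k * W z" using z(2)[of x] sub' x by (auto simp: \<omega>_def d_def)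
    finally show ?thesis using d by (simp add: power_divide field_simps)
  qed
  with d sub' z(1) wy show ?thesis by (intro that)
qed

text \<open>The constants C1, C2 and G are given independently of y, so the resulting bound is
  uniform. The pointwise estimate at the weighted maximum, suitably normalised, becomes Y <= a + c
  Y^\<theta>.\<close>

lemma growth_bound_at_point:
  fixes y :: "real^'n::finite" and v :: "real^'n \<Rightarrow> real"
  assumes n: "0 < m" "2 * m < CARD('n)"
    and \<sigma>: "0 < \<sigma>" "\<sigma> < real CARD('n) / (real CARD('n) - 2 * real m)"
    and b: "b = 2 * real m * (real CARD('n) - 2) / (real CARD('n) - \<sigma> * (real CARD('n) - 2 * real m))"
    and v: "Ck_on (2 * m) v {y. 1 / 2 < norm y}"
    and v0: "\<And>y. 1 / 2 < norm y \<Longrightarrow> 0 \<le> v y"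
    and f0: "\<And>y. 1 / 2 < norm y \<Longrightarrow> 0 \<le> - (laplacian ^^ m) v y"
    and C1: "0 < C1"
      "\<And>R. 1 \<le> R \<Longrightarrow> integral\<^sup>L lborel (\<lambda>y. indicator {y. 1 \<le> norm y \<and> norm y \<le> R} y * v y) \<le> C1 * R ^ (CARD('n) - 2 + 2 * m)"
      "\<And>R. 1 \<le> R \<Longrightarrow> integral\<^sup>L lborel (\<lambda>y. indicator {y. 1 \<le> norm y \<and> norm y \<le> R} y * (- (laplacian ^^ m) v y)) \<le> C1 * R ^ (CARD('n) - 2)"
    and C2: "0 < C2"
      "\<And>z \<rho> L I r. cball z \<rho> \<subseteq> {y. 1 / 2 < norm y} \<Longrightarrow> 0 < \<rho> \<Longrightarrow> 0 < r \<Longrightarrow>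
      (\<forall>x\<in>cball z \<rho>. 0 \<le> v x \<and> 0 \<le> - (laplacian ^^ m) v x \<and> - (laplacian ^^ m) v x \<le> L) \<Longrightarrow>
      integral\<^sup>L lborel (\<lambda>x. indicator (cball z \<rho>) x * (- (laplacian ^^ m) v x)) \<le> I \<Longrightarrow>
      v z \<le> C2 * (integral\<^sup>L lborel (\<lambda>x. indicator (cball z \<rho>) x * v x) / \<rho> ^ CARD('n)
       + L * r ^ (2 * m) + (r\<^sup>2) powr (real m - real CARD('n) / 2) * I)"
    and G: "0 < G"
    and R: "4 \<le> R" "norm y = R"
    and up: "\<And>x. x \<in> cball y (R / 2) \<Longrightarrow> - (laplacian ^^ m) v x \<le> (v x + G * R powr b) powr \<sigma>"
  defines "\<theta> \<equiv> \<sigma> * (real CARD('n) - 2 * real m) / real CARD('n)"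
  defines "a \<equiv> C2 * C1 * 2 ^ (CARD('n) + (CARD('n) - 2 + 2 * m)) + G"
  defines "c \<equiv> C2 * (2 powr (real CARD('n) * \<sigma>) + C1 * 2 ^ (CARD('n) - 2))"
  shows "v y \<le> 2 ^ CARD('n) * max 1 ((a + c) powr (1 / (1 - \<theta>))) * R powr b"
proof -
  let ?n = "CARD('n)"
  define n where "n = real ?n"
  define \<beta> where "\<beta> = 2 * real m * (n - 2) / n"
  let ?S = "{y :: real^'n. 1 / 2 < norm y}"
  have nm: "2 * real m < n" "3 \<le> n" "1 \<le> real m" using n by (auto simp: n_def)
  have n3: "2 \<le> ?n" using n by linarith
  have den: "0 < n - \<sigma> * (n - 2 * real m)"
    using \<sigma>(2) nm by (simp add: n_def field_simps)
  have \<theta>: "0 < \<theta>" "\<theta> < 1"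
    using \<sigma>(1) nm den unfolding \<theta>_def n_def[symmetric] by (auto simp: field_simps)
  have b\<theta>: "b * (1 - \<theta>) = \<beta>"
  proof -
    have "1 - \<theta> = (n - \<sigma> * (n - 2 * real m)) / n" using nm by (simp add: \<theta>_def n_def field_simps)
    then show ?thesis using den nm unfolding b \<beta>_def n_def[symmetric] by (simp add: field_simps)
  qed
  \<comment> \<open>Needed for the mean of v, which is of size R^(n-2+2m) / R^n = R^(2m-2) and must
    be absorbed into R^b.\<close>
  have b_ge: "2 * real m - 2 \<le> b"
  proof -
    have "2 * real m - 2 \<le> \<beta>" using nm by (simp add: \<beta>_def field_simps)
    also have "0 \<le> \<beta>" using nm by (simp add: \<beta>_def)
    then have "0 \<le> b" using b\<theta> \<theta> by (metis diff_gt_0_iff_gt zero_le_mult_iff not_le)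
    then have "\<beta> \<le> b" using b\<theta> \<theta> mult_left_le[of "1 - \<theta>" b] by simp
    finally show ?thesis .
  qed
  have Rpos: "0 < R" using R by linarith
  \<comment> \<open>R >= 4 places the ball in the region 1 <= |x| <= 2R of the annulus estimates and
    inside the domain of v.\<close>
  have Kin: "1 \<le> norm x \<and> norm x \<le> 2 * R" if "x \<in> cball y (R / 2)" for x
    using that R norm_triangle_ineq2[of y x] norm_triangle_ineq2[of x y] by (auto simp: dist_norm norm_minus_commute)
  then have KS: "cball y (R / 2) \<subseteq> ?S" by force
  define W where "W x = v x + G * R powr b" for x
  have GR: "0 < G * R powr b" using G Rpos by simp
  have cv: "continuous_on ?S v" using v Ck_on_imp_continuous by blast
  have cf: "continuous_on ?S (\<lambda>x. - (laplacian ^^ m) v x)"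
  proof -
    have S: "open ?S" by (intro open_Collect_less continuous_intros)
    have "continuous_on ?S ((laplacian ^^ m) v)"
      using Ck_on_laplacian_funpow[OF S, of 0 m v] v by (simp add: Ck_on_0)
    then show ?thesis by (intro continuous_intros)
  qed
  have cW: "continuous_on (cball y (R / 2)) W"
    unfolding W_def using continuous_on_subset[OF cv KS] by (intro continuous_intros)
  have Wpos: "0 < W x" if "x \<in> cball y (R / 2)" for x
  proof -
    have "0 \<le> v x" using that KS v0 by blast
    then show ?thesis using GR by (simp add: W_def)
  qed
  obtain z d where d: "0 < d" "d \<le> R / 2" and zK: "cball z (d / 2) \<subseteq> cball y (R / 2)" "z \<in> cball y (R / 2)"
    and Wz: "\<And>x. x \<in> cball z (d / 2) \<Longrightarrow> W x \<le> 2 ^ ?n * W z" and Wy: "(R / 2) ^ ?n * W y \<le> d ^ ?n * W z"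
    by (rule max_weighted_ball[of "R / 2" y W ?n]) (use Rpos cW Wpos in auto)
  define M where "M = W z"
  have M: "0 < M" using Wpos zK by (simp add: M_def)
  define L where "L = (2 ^ ?n * M) powr \<sigma>"
  define A where "A = integral\<^sup>L lborel (\<lambda>x. indicator (cball z (d / 2)) x * v x)"
  define I where "I = C1 * (2 * R) ^ (?n - 2)"
  \<comment> \<open>With this radius the last two terms of the pointwise estimate become constant
    multiples of M^\<theta> R^\<beta>.\<close>
  define r where "r = R powr ((n - 2) / n) * M powr (- \<sigma> / n)"
  note rad = balancing_radius[OF Rpos M, of n \<sigma>, folded r_def]
  have sub: "cball z (d / 2) \<subseteq> {x. 1 \<le> norm x \<and> norm x \<le> 2 * R}"
    using zK(1) Kin by blast
  have AS: "{x :: real^'n. 1 \<le> norm x \<and> norm x \<le> 2 * R} \<subseteq> ?S" by auto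
  have mono: "integral\<^sup>L lborel (\<lambda>x. indicator (cball z (d / 2)) x * h x)
      \<le> integral\<^sup>L lborel (\<lambda>x. indicator {x. 1 \<le> norm x \<and> norm x \<le> 2 * R} x * h x)"
    if "continuous_on ?S h" "\<And>x. x \<in> ?S \<Longrightarrow> 0 \<le> h x"
    for h :: "real^'n \<Rightarrow> real"
  proof (rule integral_mono)
    show "integrable lborel (\<lambda>x. indicator (cball z (d / 2)) x * h x)"
      using that(1) zK KS by (intro integrable_indicator_mult compact_cball) (blast intro: continuous_on_subset)
    show "integrable lborel (\<lambda>x. indicator {x. 1 \<le> norm x \<and> norm x \<le> 2 * R} x * h x)"
      using that(1) AS by (intro integrable_indicator_mult compact_closed_annulus) (blast intro: continuous_on_subset)
    show "indicator (cball z (d / 2)) x * h x \<le> indicator {x. 1 \<le> norm x \<and> norm x \<le> 2 * R} x * h x" for x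
    proof (cases "x \<in> {x. 1 \<le> norm x \<and> norm x \<le> 2 * R}")
      case True
      then have "0 \<le> h x" using AS that(2) by blast
      then show ?thesis using True by (intro mult_right_mono) (auto simp: indicator_def)
    next
      case False
      then show ?thesis using sub by (auto simp: indicator_def)
    qed
  qed
  have A: "A \<le> C1 * (2 * R) ^ (?n - 2 + 2 * m)"
    unfolding A_def using mono[OF cv] v0 C1(2)[of "2 * R"] R by force
  have I: "integral\<^sup>L lborel (\<lambda>x. indicator (cball z (d / 2)) x * (- (laplacian ^^ m) v x)) \<le> I"
    unfolding I_def using mono[OF cf] f0 C1(3)[of "2 * R"] R by force
  have h: "\<forall>x\<in>cball z (d / 2). 0 \<le> v x \<and> 0 \<le> - (laplacian ^^ m) v x \<and> - (laplacian ^^ m) v x \<le> L"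
  proof
    fix x assume x: "x \<in> cball z (d / 2)"
    then have xK: "x \<in> cball y (R / 2)" and xS: "1 / 2 < norm x" using zK KS by auto
    have "- (laplacian ^^ m) v x \<le> W x powr \<sigma>" using up[OF xK] by (simp add: W_def)
    also have "\<dots> \<le> L" unfolding L_def using Wz[OF x] Wpos[OF xK] \<sigma>(1)
      by (intro powr_mono2) (auto simp: M_def)
    finally show "0 \<le> v x \<and> 0 \<le> - (laplacian ^^ m) v x \<and> - (laplacian ^^ m) v x \<le> L"
      using v0[OF xS] f0[OF xS] by simp
  qed
  have n0: "0 < n" using nm by linarith
  note rad = rad[OF n0]
  have "v z \<le> C2 * (A / (d / 2) ^ ?n + L * r ^ (2 * m) + (r\<^sup>2) powr (real m - n / 2) * I)"
    unfolding A_def n_def using zK KS d rad(1) h I by (intro C2(2)) auto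
  also have "L * r ^ (2 * m) = 2 powr (n * \<sigma>) * (M powr \<theta> * R powr \<beta>)"
  proof -
    have "L = 2 powr (n * \<sigma>) * M powr \<sigma>"
      using M by (simp add: L_def n_def powr_mult powr_powr flip: powr_realpow)
    then show ?thesis using rad(2)[of m] by (simp add: \<theta>_def \<beta>_def n_def)
  qed
  also have "(r\<^sup>2) powr (real m - n / 2) * I = C1 * 2 ^ (?n - 2) * (M powr \<theta> * R powr \<beta>)"
  proof -
    have "R powr (n - 2) = R ^ (?n - 2)"
      using Rpos n3 by (simp add: n_def of_nat_diff flip: powr_realpow)
    then show ?thesis using rad(3)[of m] by (simp add: I_def power_mult_distrib \<theta>_def \<beta>_def n_def)
  qed
  finally have vz: "v z \<le> C2 * (A / (d / 2) ^ ?n) + c * (M powr \<theta> * R powr \<beta>)"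
    by (simp add: c_def n_def algebra_simps)
  \<comment> \<open>Multiplication by t cancels the volume factor (d/2)^n, about which no lower
    bound is known, up to R^n and a constant.\<close>
  define t where "t = (d / R) ^ ?n"
  have t: "0 < t" "t \<le> 1" using d Rpos by (auto simp: t_def intro!: power_le_one)
  define Y where "Y = t * M / R powr b"
  have Y: "0 < Y" using t M Rpos by (simp add: Y_def)
  have RR: "R ^ (?n - 2 + 2 * m) \<le> R ^ ?n * R powr b"
  proof -
    have "real (?n - 2 + 2 * m) = n + (2 * real m - 2)"
      using n3 by (simp add: n_def of_nat_diff)
    then have "R ^ (?n - 2 + 2 * m) = R powr (n + (2 * real m - 2))"
      using powr_realpow[OF Rpos, of "?n - 2 + 2 * m"] by metis
    also have "\<dots> = R ^ ?n * R powr (2 * real m - 2)"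
      using Rpos by (simp add: n_def powr_add powr_realpow)
    also have "\<dots> \<le> R ^ ?n * R powr b"
      using R b_ge Rpos by (intro mult_left_mono powr_mono) auto
    finally show ?thesis .
  qed
  have e1: "t * (A / (d / 2) ^ ?n) \<le> C1 * 2 ^ (?n + (?n - 2 + 2 * m)) * R powr b"
  proof -
    have "t * (A / (d / 2) ^ ?n) = 2 ^ ?n * A / R ^ ?n"
      using d by (simp add: t_def power_divide)
    also have "\<dots> \<le> 2 ^ ?n * (C1 * (2 * R) ^ (?n - 2 + 2 * m)) / R ^ ?n"
      using A Rpos by (intro divide_right_mono mult_left_mono) auto
    also have "\<dots> = C1 * 2 ^ (?n + (?n - 2 + 2 * m)) * (R ^ (?n - 2 + 2 * m) / R ^ ?n)"
      by (simp add: power_add power_mult_distrib)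
    also have "\<dots> \<le> C1 * 2 ^ (?n + (?n - 2 + 2 * m)) * R powr b"
      using RR C1(1) Rpos by (intro mult_left_mono) (auto simp: divide_le_eq mult.commute)
    finally show ?thesis .
  qed
  have e2: "t * (M powr \<theta> * R powr \<beta>) \<le> Y powr \<theta> * R powr b"
  proof -
    \<comment> \<open>As t <= 1 and \<theta> < 1, the factor t can be weakened to t^\<theta>, which
      combines with M^\<theta> into a power of t M.\<close>
    have "t \<le> t powr \<theta>" using t \<theta> powr_mono'[of \<theta> 1 t] by simp
    then have "t * (M powr \<theta> * R powr \<beta>) \<le> t powr \<theta> * (M powr \<theta> * R powr \<beta>)"
      by (rule mult_right_mono) simp
    also have "\<dots> = (t * M) powr \<theta> * R powr \<beta>" using t M by (simp add: powr_mult)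
    also have "t * M = Y * R powr b" using Rpos by (simp add: Y_def)
    also have "(Y * R powr b) powr \<theta> * R powr \<beta> = Y powr \<theta> * R powr (b * \<theta> + \<beta>)"
      using Y by (simp add: powr_mult powr_powr powr_add)
    \<comment> \<open>This identity determines b: with it every term scales like R^b.\<close>
    also have "b * \<theta> + \<beta> = b" using b\<theta> by (simp add: algebra_simps)
    finally show ?thesis .
  qed
  have c0: "0 \<le> c" using C1 C2 by (simp add: c_def)
  have a0: "0 \<le> a" using C1 C2 G by (simp add: a_def)
  have "t * M = t * v z + t * (G * R powr b)" by (simp add: M_def W_def algebra_simps)
  also have "t * v z \<le> t * (C2 * (A / (d / 2) ^ ?n) + c * (M powr \<theta> * R powr \<beta>))"
    using vz t by (intro mult_left_mono) auto
  also have "t * (G * R powr b) \<le> G * R powr b" using t GR by (simp add: mult_left_le_one_le)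
  also have "t * (C2 * (A / (d / 2) ^ ?n) + c * (M powr \<theta> * R powr \<beta>))
    = C2 * (t * (A / (d / 2) ^ ?n)) + c * (t * (M powr \<theta> * R powr \<beta>))" by (simp add: algebra_simps)
  also have "C2 * (t * (A / (d / 2) ^ ?n)) \<le> C2 * (C1 * 2 ^ (?n + (?n - 2 + 2 * m)) * R powr b)"
    using e1 C2(1) by (intro mult_left_mono) auto
  also have "c * (t * (M powr \<theta> * R powr \<beta>)) \<le> c * (Y powr \<theta> * R powr b)"
    using e2 c0 by (intro mult_left_mono) auto
  finally have "t * M \<le> (a + c * Y powr \<theta>) * R powr b"
    by (simp add: a_def algebra_simps)
  then have "Y \<le> a + c * Y powr \<theta>" using Rpos by (simp add: Y_def divide_le_eq)
  then have YT: "Y \<le> max 1 ((a + c) powr (1 / (1 - \<theta>)))"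
    by (rule sublinear_bound[OF \<theta> a0 c0])
  have "v y \<le> W y" using GR by (simp add: W_def)
  also have "W y \<le> 2 ^ ?n * (t * M)"
    using Wy Rpos by (simp add: t_def M_def power_divide field_simps)
  also have "t * M = Y * R powr b" using Rpos by (simp add: Y_def)
  also have "2 ^ ?n * (Y * R powr b) \<le> 2 ^ ?n * (max 1 ((a + c) powr (1 / (1 - \<theta>))) * R powr b)"
    using YT by (intro mult_left_mono mult_right_mono) auto
  finally show ?thesis by (simp add: mult.assoc)
qed

section \<open>From the uniform bound at a point to the growth estimate\<close>

theorem theorem4p1:
  fixes m :: nat and \<sigma> b :: real
    and g v :: "real^'n::finite \<Rightarrow> real"
  assumes m2: "m \<ge> 2" and modd: "odd m"
    and n2: "CARD('n) \<ge> 2" and mn: "2 * m < CARD('n)"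
    and sig_pos: "0 < \<sigma>"
    and sig_bd: "\<sigma> < real CARD('n) / (real CARD('n) - 2 * real m)"
    and b_def: "b = 2 * real m * (real CARD('n) - 2)
                     / (real CARD('n) - \<sigma> * (real CARD('n) - 2 * real m))"
    and g_cont: "continuous_on {y. 1/2 \<le> norm y} g"
    and g_ge1: "\<And>y. 1/2 \<le> norm y \<Longrightarrow> 1 \<le> g y"
    and g_growth: "g \<in> O[at_infinity](\<lambda>y. norm y powr b)"
    and v_smooth: "Ck_on (2 * m) v {y. 1/2 < norm y}"
    and v_nonneg: "\<And>y. 1/2 \<le> norm y \<Longrightarrow> 0 \<le> v y"
    and ineq_lower: "\<And>y. 1/2 < norm y \<Longrightarrow> 0 \<le> - ((laplacian ^^ m) v y)"
    and ineq_upper: "\<And>y. 1/2 < norm y \<Longrightarrow> - ((laplacian ^^ m) v y) \<le> (v y + g y) powr \<sigma>"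
  shows "v \<in> O[at_infinity](\<lambda>y. norm y powr b)"
proof -
  let ?n = "CARD('n)" and ?S = "{y :: real^'n. 1 / 2 < norm y}"
  have n3: "3 \<le> ?n" using m2 mn by linarith
  have v0: "0 \<le> v y" if "1 / 2 < norm y" for y using that v_nonneg by simp
  have S: "open ?S" by (intro open_Collect_less continuous_intros)
  have "\<exists>C>0. \<forall>R\<ge>1.
    integral\<^sup>L lborel (\<lambda>y. indicator {y. 1 \<le> norm y \<and> norm y \<le> R} y * v y) \<le> C * R ^ (?n - 2 + 2 * m) \<and>
    integral\<^sup>L lborel (\<lambda>y. indicator {y. 1 \<le> norm y \<and> norm y \<le> R} y * (- (laplacian ^^ m) v y)) \<le> C * R ^ (?n - 2)"
    by (rule annulus_integral_estimates[OF n3 v_smooth]) (fact v0, fact ineq_lower)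
  then obtain C1 where C1: "0 < C1" "\<forall>R\<ge>1.
    integral\<^sup>L lborel (\<lambda>y. indicator {y. 1 \<le> norm y \<and> norm y \<le> R} y * v y) \<le> C1 * R ^ (?n - 2 + 2 * m) \<and>
    integral\<^sup>L lborel (\<lambda>y. indicator {y. 1 \<le> norm y \<and> norm y \<le> R} y * (- (laplacian ^^ m) v y)) \<le> C1 * R ^ (?n - 2)"
    by (elim exE conjE) (rule that)
  obtain C2 where C2: "0 < C2" "\<forall>S v (z :: real^'n) \<rho> L I r.
    open S \<longrightarrow> cball z \<rho> \<subseteq> S \<longrightarrow> 0 < \<rho> \<longrightarrow> 0 < r \<longrightarrow> Ck_on (2 * m) v S \<longrightarrow>
    (\<forall>x\<in>cball z \<rho>. 0 \<le> v x \<and> 0 \<le> - (laplacian ^^ m) v x \<and> - (laplacian ^^ m) v x \<le> L) \<longrightarrow>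
    integral\<^sup>L lborel (\<lambda>x. indicator (cball z \<rho>) x * (- (laplacian ^^ m) v x)) \<le> I \<longrightarrow>
    v z \<le> C2 * (integral\<^sup>L lborel (\<lambda>x. indicator (cball z \<rho>) x * v x) / \<rho> ^ ?n
       + L * r ^ (2 * m) + (r\<^sup>2) powr (real m - real ?n / 2) * I)"
    using pointwise_estimate[OF modd mn] by (elim exE conjE) (rule that)
  note C2' = C2(2)[rule_format, OF S _ _ _ v_smooth]
  obtain cg where cg: "0 < cg" "eventually (\<lambda>y. norm (g y) \<le> cg * norm (norm y powr b)) at_infinity"
    using g_growth by (rule landau_o.bigE)
  then obtain R1 where R1: "\<And>y. R1 \<le> norm y \<Longrightarrow> norm (g y) \<le> cg * norm (norm y powr b)"
    unfolding eventually_at_infinity by blast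
  have b0: "0 \<le> b"
  proof -
    have "0 < real ?n - \<sigma> * (real ?n - 2 * real m)" using sig_bd mn by (simp add: field_simps)
    then show ?thesis unfolding b_def using n2 by simp
  qed
  \<comment> \<open>Points within |y|/2 of y have norm at most 3/2 |y|; since b >= 0, this constant
    dominates g on the whole ball.\<close>
  define G where "G = cg * (3 / 2) powr b"
  have G: "0 < G" using cg by (simp add: G_def)
  define \<theta> where "\<theta> = \<sigma> * (real ?n - 2 * real m) / real ?n"
  define a where "a = C2 * C1 * 2 ^ (?n + (?n - 2 + 2 * m)) + G"
  define c where "c = C2 * (2 powr (real ?n * \<sigma>) + C1 * 2 ^ (?n - 2))"
  define T where "T = 2 ^ ?n * max 1 ((a + c) powr (1 / (1 - \<theta>)))"
  \<comment> \<open>The threshold 2 R1 keeps the ball of radius |y|/2 where the bound on g holds,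
    and 4 is what the pointwise growth bound requires.\<close>
  have "v y \<le> T * norm y powr b" if y: "max 4 (2 * R1) \<le> norm y" for y
    unfolding T_def a_def c_def \<theta>_def
  proof (rule growth_bound_at_point[OF _ mn sig_pos sig_bd b_def v_smooth v0 ineq_lower C1(1) _ _ C2(1) C2' G])
    show "- (laplacian ^^ m) v x \<le> (v x + G * norm y powr b) powr \<sigma>" if x: "x \<in> cball y (norm y / 2)" for x
    proof -
      have nx: "norm y / 2 \<le> norm x" "norm x \<le> 3 / 2 * norm y"
        using x norm_triangle_ineq2[of y x] norm_triangle_ineq2[of x y]
        by (auto simp: dist_norm norm_minus_commute)
      have x1: "R1 \<le> norm x" "1 / 2 < norm x" using nx y by auto
      have "g x \<le> cg * norm x powr b" using R1[OF x1(1)] by simp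
      also have "\<dots> \<le> cg * (3 / 2 * norm y) powr b"
        using nx b0 cg(1) by (intro mult_left_mono powr_mono2) auto
      also have "\<dots> = G * norm y powr b" by (subst powr_mult) (auto simp: G_def)
      finally have "v x + g x \<le> v x + G * norm y powr b" by simp
      moreover have "0 \<le> v x + g x" using v0[of x] g_ge1[of x] x1 by simp
      ultimately have "(v x + g x) powr \<sigma> \<le> (v x + G * norm y powr b) powr \<sigma>"
        using sig_pos by (intro powr_mono2) auto
      then show ?thesis using ineq_upper[OF x1(2)] by linarith
    qed
  qed (use C1(2) y m2 in auto)
  then have "eventually (\<lambda>y. norm (v y) \<le> T * norm (norm y powr b)) at_infinity"
    unfolding eventually_at_infinity using v_nonneg
    by (intro exI[of _ "max 4 (2 * R1)"]) auto
  then show ?thesis by (rule landau_o.bigI[rotated]) (simp add: T_def)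
qed

end
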